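(* Let $\{\xi(k),k\in\mathbb{Z}\}$ be a stationary sequence of random variables, independent of the random walk $\{S_n\}$, such that $n\,\mathbb{P}(\xi>u_n)\to\tau$ as $n\to\infty$ for some real sequence $(u_n)$ and some $\tau>0$. Assume $\alpha<1$ and that the conditions $\mathbf{D}(u_n)$ and $\mathbf{D}'(u_n)$ hold for the sequence $\{\xi(k),k\in\mathbb{Z}\}$. Then the sequence $\{\xi(S_n),n\in\mathbb{N}\}$ satisfies the $D(u_n)$ condition.
   Context: Random walk: $\{X_k,k\in\mathbb{N}_+\}$ are i.i.d. integer-valued centered random variables (i.e. $\mathbb{E}X_1=0$ whenever the mean exists), $S_0=0$, $S_n=X_1+\cdots+X_n$, and $\mathbb{P}(S_n/n^{1/\alpha}\le x)\to F_\alpha(x)$ for every $x\in\mathbb{R}$, where $F_\alpha$ is the distribution function of the stable law with characteristic function $\phi(\theta)=\exp(-|\theta|^\alpha(C_1+iC_2\,\mathrm{sgn}\,\theta))$, $\alpha\in(0,2]$. $[\cdot]$ is the integer part. $\xi$ denotes a random variable with the law of $\xi(k)$; stationary means strictly stationary. Probabilities are with respect to both the walk and the scenery. Conditions, for a sequence $\{\zeta(k)\}$ of real random variables indexed by $\mathbb{Z}$ or $\mathbb{N}$. For indices $i_1<\cdots<i_p$ and $u\in\mathbb{R}$ let $F_{i_1,\ldots,i_p}(u)=\mathbb{P}(\zeta(i_1)\le u,\ldots,\zeta(i_p)\le u)$. $D(u_n)$ (also written $\mathbf{D}(u_n)$): there exist a family $(\alpha_{n,l})_{(n,l)\in\mathbb{N}^2}$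 and a sequence $(l_n)$ of positive integers such that $\alpha_{n,l_n}\to0$, $l_n=o(n)$, and $|F_{i_1,\ldots,i_p,j_1,\ldots,j_{p'}}(u_n)-F_{i_1,\ldots,i_p}(u_n)F_{j_1,\ldots,j_{p'}}(u_n)|\le\alpha_{n,l}$ for all indices $i_1<\cdots<i_p<j_1<\cdots<j_{p'}$ with $j_1-i_p\ge l$ (uniformly in $p,p'$). $\mathbf{D}'(u_n)$: there is a sequence of integers $(k_n)$ with $k_n\to\infty$, $\frac{n^2}{k_n}\alpha_{n,l_n}\to0$ and $k_nl_n=o(n)$, where $(l_n)$ and $(\alpha_{n,l})$ are those of $\mathbf{D}(u_n)$, such that $\lim_{n\to\infty}n\sum_{j=1}^{[n/k_n]}\mathbb{P}(\zeta(0)>u_n,\zeta(j)>u_n)=0$. *)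

theory Defs
  imports "HOL-Probability.Probability"
begin

definition walk :: "(nat \<Rightarrow> 'a \<Rightarrow> int) \<Rightarrow> nat \<Rightarrow> 'a \<Rightarrow> int" where
  "walk X n \<omega> = (\<Sum>k=1..n. X k \<omega>)"

(* "Stable law" means non-degenerate, hence C1 > 0.  No bound on C2 is imposed: the usual one
   follows from the right-hand side being a characteristic function. *)
definition stable_law :: "real \<Rightarrow> real \<Rightarrow> real \<Rightarrow> real measure \<Rightarrow> bool" where
  "stable_law \<alpha> C1 C2 \<mu> \<longleftrightarrow>
     real_distribution \<mu> \<and> 0 < \<alpha> \<and> \<alpha> \<le> 2 \<and> 0 < C1 \<and>
     (\<forall>\<theta>. char \<mu> \<theta> =
        exp (- complex_of_real (\<bar>\<theta>\<bar> powr \<alpha>) * (complex_of_real C1 + \<i> * complex_of_real (C2 * sgn \<theta>))))"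

definition strictly_stationary :: "'a measure \<Rightarrow> (int \<Rightarrow> 'a \<Rightarrow> real) \<Rightarrow> bool" where
  "strictly_stationary M \<xi> \<longleftrightarrow>
     (\<forall>k. \<xi> k \<in> borel_measurable M) \<and>
     (\<forall>h::int. distr M (Pi\<^sub>M UNIV (\<lambda>_. borel)) (\<lambda>\<omega> (k::int). \<xi> (k + h) \<omega>) =
          distr M (Pi\<^sub>M UNIV (\<lambda>_. borel)) (\<lambda>\<omega> (k::int). \<xi> k \<omega>))"

(* Independence of two whole processes, as independence of the sigma-algebras they generate.
   The library's indep_var requires both random variables to have values in the same type. *)
definition indep_processes ::
  "'a measure \<Rightarrow> ('i \<Rightarrow> 'b measure) \<Rightarrow> ('i \<Rightarrow> 'a \<Rightarrow> 'b) \<Rightarrow>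
   ('j \<Rightarrow> 'c measure) \<Rightarrow> ('j \<Rightarrow> 'a \<Rightarrow> 'c) \<Rightarrow> bool" where
  "indep_processes M N Y N' Z \<longleftrightarrow>
     prob_space.indep_set M
       (sets (vimage_algebra (space M) (\<lambda>\<omega> i. Y i \<omega>) (Pi\<^sub>M UNIV N)))
       (sets (vimage_algebra (space M) (\<lambda>\<omega> j. Z j \<omega>) (Pi\<^sub>M UNIV N')))"

(* A strictly increasing tuple of indices is represented by the finite nonempty set of its entries. *)
definition joint_df :: "'a measure \<Rightarrow> ('i \<Rightarrow> 'a \<Rightarrow> real) \<Rightarrow> 'i set \<Rightarrow> real \<Rightarrow> real" where
  "joint_df M \<zeta> I u = measure M {\<omega> \<in> space M. \<forall>i\<in>I. \<zeta> i \<omega> \<le> u}"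

(* The index type is intended to be nat or int.  The coefficients a and the gaps l are explicit
   because condition D' below refers to those of condition D. *)
definition D_cond_with ::
  "'a measure \<Rightarrow> ('i::linordered_semidom \<Rightarrow> 'a \<Rightarrow> real) \<Rightarrow> (nat \<Rightarrow> real) \<Rightarrow>
   (nat \<Rightarrow> nat \<Rightarrow> real) \<Rightarrow> (nat \<Rightarrow> nat) \<Rightarrow> bool" where
  "D_cond_with M \<zeta> u a l \<longleftrightarrow>
     (\<forall>n. 0 < l n) \<and>
     (\<lambda>n. a n (l n)) \<longlonglongrightarrow> 0 \<and>
     (\<lambda>n. real (l n)) \<in> o(\<lambda>n. real n) \<and>
     (\<forall>n m I J. finite I \<longrightarrow> I \<noteq> {} \<longrightarrow> finite J \<longrightarrow> J \<noteq> {} \<longrightarrow>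
        Max I < Min J \<longrightarrow> Max I + of_nat m \<le> Min J \<longrightarrow>
        \<bar>joint_df M \<zeta> (I \<union> J) (u n) - joint_df M \<zeta> I (u n) * joint_df M \<zeta> J (u n)\<bar> \<le> a n m)"

definition D_cond ::
  "'a measure \<Rightarrow> ('i::linordered_semidom \<Rightarrow> 'a \<Rightarrow> real) \<Rightarrow> (nat \<Rightarrow> real) \<Rightarrow> bool" where
  "D_cond M \<zeta> u \<longleftrightarrow> (\<exists>a l. D_cond_with M \<zeta> u a l)"

definition D'_cond_with ::
  "'a measure \<Rightarrow> ('i::linordered_semidom \<Rightarrow> 'a \<Rightarrow> real) \<Rightarrow> (nat \<Rightarrow> real) \<Rightarrow>
   (nat \<Rightarrow> nat \<Rightarrow> real) \<Rightarrow> (nat \<Rightarrow> nat) \<Rightarrow> bool" where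
  "D'_cond_with M \<zeta> u a l \<longleftrightarrow>
     (\<exists>k :: nat \<Rightarrow> nat.
        filterlim k at_top sequentially \<and>
        (\<lambda>n. (real n)\<^sup>2 / real (k n) * a n (l n)) \<longlonglongrightarrow> 0 \<and>
        (\<lambda>n. real (k n * l n)) \<in> o(\<lambda>n. real n) \<and>
        (\<lambda>n. real n * (\<Sum>j=1..n div k n.
            measure M {\<omega> \<in> space M. \<zeta> 0 \<omega> > u n \<and> \<zeta> (of_nat j) \<omega> > u n})) \<longlonglongrightarrow> 0)"

end

theory Submission
  imports Defs "HOL-Real_Asymp.Real_Asymp"
begin

text \<open>
  Write \<open>F\<close> for the map that sends a finite set of sites to the probability that the scenery stays
  below the level \<open>u n\<close> on it. As walk and scenery are independent, the joint distribution function
  of the scenery seen at the times in \<open>I\<close> is the expectation of \<open>F\<close> at the random set of sites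
  that the walk occupies at these times (\<open>G_eq_expectation\<close>). So for time sets \<open>I\<close> and \<open>J\<close>,
  with \<open>J\<close> after \<open>I\<close>, the question is how \<open>F\<close> factorises over two sets of sites \<open>A\<close> (visited during
  \<open>I\<close>) and \<open>B\<close> (visited during \<open>J\<close>).
  
  There are two sources of dependence. The sets \<open>A\<close> and \<open>B\<close> are not independent of each other;
  but the shape of \<open>B\<close> relative to the position of the walk at the last time of \<open>I\<close> is independent of \<open>A\<close>,
  and \<open>F\<close> is invariant under translations because the scenery is stationary, so the expectation
  of \<open>F A * F B\<close> is exactly the product of the expectations (\<open>G_mult_eq_expectation\<close>).
  The other source is that \<open>A\<close> and \<open>B\<close> may interlace on the integer line, while the mixing condition on the scenery
  only treats sets of which one lies to the left of the other. If all points of \<open>A\<close> are at distance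
  at least \<open>l n\<close> from all points of \<open>B\<close>, cutting the union at every alternation costs one mixing error
  per cut, hence at most a multiple of \<open>card A + card B\<close> errors (\<open>mixing_separated\<close>). This is
  negligible when the two sets have of the order of \<open>n\<close> points, because the anti-clustering condition forces the
  mixing error to be \<open>o(1/n)\<close>. Points of one set that are too close to the other are discarded, at the price
  \<open>P(\<xi> > u n) = O(1/n)\<close> each.
  
  It remains to see that few points are close and that big time sets do no harm. The first
  is where the index \<open>\<alpha> < 1\<close> enters: the walk escapes to infinity faster than linearly, so the probability
  that \<open>\<bar>S m\<bar> < g\<close> for some \<open>m \<ge> g\<close> tends to \<open>0\<close> as \<open>g\<close> grows (\<open>walk_transient\<close>). With a time gap
  \<open>g n\<close> that is at least \<open>l n\<close> and of order \<open>o(n)\<close>, each point is close to the other set with a probability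
  that tends to \<open>0\<close>. For the second, a time set with at least a large multiple of \<open>n\<close> elements leads the walk to
  at least a multiple of \<open>n\<close> distinct sites, by the same escape property (\<open>G_le_of_many_times\<close>), and the two
  conditions on the scenery imply that \<open>F\<close> is uniformly small on sets of that size, as in the classical extreme
  value theory of stationary sequences (\<open>F_large_sets_small\<close>). Then all the probabilities in
  question are small.
  
  The escape property rests on the bound \<open>P(\<bar>S m\<bar> \<le> r) \<le> C * (r powr \<alpha> / m) powr p\<close> with an exponent \<open>p > 1\<close>.
  It comes from the decay \<open>exp (- c * \<theta> powr \<alpha>)\<close> of the characteristic function of a step
  near \<open>0\<close>, which convergence to the stable law forces.
\<close>

section \<open>Concentration from decay of the characteristic function\<close>

lemma cos_ge_half: "1 / 2 \<le> cos x" if "\<bar>x\<bar> \<le> 1" for x :: real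
proof -
  have "(sin (x / 2))\<^sup>2 \<le> (x / 2)\<^sup>2"
    using abs_sin_x_le_abs_x[of "x / 2"] by (simp only: abs_le_square_iff)
  moreover have "(x / 2)\<^sup>2 \<le> (1 / 2)\<^sup>2"
    using that by (subst abs_le_square_iff[symmetric]) simp
  moreover have "cos x = 1 - 2 * (sin (x / 2))\<^sup>2"
    using cos_double_sin[of "x / 2"] by simp
  ultimately show ?thesis by (simp add: power2_eq_square)
qed

text \<open>
  Weighted arithmetic-geometric means bound each term by the increment of the right-hand side,
  so the sum telescopes.
\<close>

lemma sum_powr_neg_le:
  assumes "0 \<le> q" "q < 1"
  shows "(\<Sum>i=1..n. real i powr - q) \<le> real n powr (1 - q) / (1 - q)"
proof (induction n)
  case 0
  then show ?case by simp
next
  case (Suc n)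
  have "(1 - q) * real (Suc n) powr - q \<le> real (Suc n) powr (1 - q) - real n powr (1 - q)"
  proof (cases "n = 0")
    case True
    then show ?thesis using assms by simp
  next
    case False
    define x where "x = real n / real (Suc n)"
    have "x powr (1 - q) * 1 powr q \<le> (1 - q) * x + q * 1"
      using assms False by (intro Youngs_inequality_0) (auto simp: x_def)
    then have "real (Suc n) powr (1 - q) * x powr (1 - q) \<le> real (Suc n) powr (1 - q) * ((1 - q) * x + q)"
      by (intro mult_left_mono) auto
    also have "real (Suc n) powr (1 - q) * x powr (1 - q) = real n powr (1 - q)"
      by (subst powr_mult[symmetric]) (auto simp: x_def)
    also have "(1 - q) * x + q = 1 - (1 - q) / real (Suc n)"
      by (simp add: x_def field_simps)
    also have "real (Suc n) powr (1 - q) * (1 - (1 - q) / real (Suc n)) =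
        real (Suc n) powr (1 - q) - (1 - q) * real (Suc n) powr - q"
      by (simp add: right_diff_distrib powr_diff powr_minus divide_simps del: of_nat_Suc)
         (simp add: algebra_simps del: of_nat_Suc)
    finally show ?thesis by simp
  qed
  with Suc assms show ?case
    by (simp add: field_simps)
qed

text \<open>
  Only polynomial decay is kept of the exponential. The exponent \<open>p\<close> remains free,
  so that it can be chosen such that the resulting power of \<open>\<theta>\<close> is summable near \<open>0\<close>.
\<close>

lemma exp_minus_le_powr:
  assumes "0 < x" "0 < p"
  shows "exp (- x) \<le> (p / x) powr (p :: real)"
proof -
  have "x / p \<le> exp (x / p)"
    using exp_ge_add_one_self[of "x / p"] by linarith
  then have "(x / p) powr p \<le> exp (x / p) powr p"
    using assms by (intro powr_mono2) auto
  also have "\<dots> = exp x"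
    using assms by (simp add: powr_def)
  finally have "inverse (exp x) \<le> inverse ((x / p) powr p)"
    using assms by (intro le_imp_inverse_le) auto
  then show ?thesis
    using assms by (simp add: exp_minus powr_divide)
qed

lemma cmod_char_minus: "cmod (char M (- t)) = cmod (char M t)"
proof -
  have "char M (- t) = (\<integral>x. cnj (iexp (t * x)) \<partial>M)"
    unfolding char_def by (intro Bochner_Integration.integral_cong) (auto simp: exp_cnj)
  then show ?thesis
    by (simp add: char_def del: of_real_mult)
qed

text \<open>
  A discrete form of Esseen's concentration inequality. The exponential sum
  \<open>E = (\<Sum>j<N. exp (i j \<delta> Y))\<close> with \<open>N \<delta> = 1 / r\<close> has real part at least \<open>N / 2\<close> where \<open>\<bar>Y\<bar> \<le> r\<close>, and its
  second moment expands into a double sum of values of the characteristic function at the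
  multiples of \<open>\<delta>\<close>. Only frequencies up to \<open>1 / r\<close> occur, which matters because nothing is
  known about the characteristic function far from \<open>0\<close>: that of a lattice law is even periodic.
\<close>

lemma (in prob_space) prob_abs_le_char_sum:
  fixes Y :: "'a \<Rightarrow> real" and r :: real and N :: nat
  assumes [measurable]: "Y \<in> borel_measurable M" and "0 < r" "0 < N"
  shows "prob {\<omega> \<in> space M. \<bar>Y \<omega>\<bar> \<le> r} \<le>
    4 / N + 8 / N * (\<Sum>i=1..N. cmod (char (distr M borel Y) (i * (1 / (r * N)))))"
proof -
  define \<delta> where "\<delta> = 1 / (r * N)"
  define h where "h i = cmod (char (distr M borel Y) (i * \<delta>))" for i :: real
  define E where "E \<omega> = (\<Sum>j<N. iexp (j * \<delta> * Y \<omega>))" for \<omega>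
  have \<delta>: "0 < \<delta>" using assms by (simp add: \<delta>_def)
  have h_minus: "h (- i) = h i" for i
    using cmod_char_minus[of "distr M borel Y" "i * \<delta>"] by (simp add: h_def)
  have h_nonneg: "0 \<le> h i" for i by (simp add: h_def)
  interpret Y: real_distribution "distr M borel Y"
    by (simp add: real_distribution_distr)
  have h_0: "h 0 = 1"
    by (simp add: h_def Y.char_zero)
  have sq: "complex_of_real ((cmod (E \<omega>))\<^sup>2) = (\<Sum>j<N. \<Sum>k<N. iexp ((real j - real k) * \<delta> * Y \<omega>))" for \<omega>
    unfolding complex_norm_square E_def cnj_sum sum_product
    by (intro sum.cong) (simp_all add: exp_cnj algebra_simps flip: exp_add)
  have meas [measurable]: "E \<in> borel_measurable M"
    unfolding E_def by measurable
  have int: "integrable M (\<lambda>\<omega>. iexp (t * Y \<omega>))" for t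
    by (intro integrable_iexp) auto
  have "complex_of_real (\<integral>\<omega>. (cmod (E \<omega>))\<^sup>2 \<partial>M) = (\<integral>\<omega>. complex_of_real ((cmod (E \<omega>))\<^sup>2) \<partial>M)"
    by (simp del: of_real_power)
  also have "\<dots> = (\<Sum>j<N. \<Sum>k<N. \<integral>\<omega>. iexp ((real j - real k) * \<delta> * Y \<omega>) \<partial>M)"
    unfolding sq using int by (simp only: Bochner_Integration.integral_sum Bochner_Integration.integrable_sum)
  also have "\<dots> = (\<Sum>j<N. \<Sum>k<N. char (distr M borel Y) ((real j - real k) * \<delta>))"
    by (simp add: char_def integral_distr)
  finally have eq: "complex_of_real (\<integral>\<omega>. (cmod (E \<omega>))\<^sup>2 \<partial>M) =
    (\<Sum>j<N. \<Sum>k<N. char (distr M borel Y) ((real j - real k) * \<delta>))" .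
  have "(\<integral>\<omega>. (cmod (E \<omega>))\<^sup>2 \<partial>M) = cmod (\<Sum>j<N. \<Sum>k<N. char (distr M borel Y) ((real j - real k) * \<delta>))"
    unfolding eq[symmetric] norm_of_real by (rule abs_of_nonneg[symmetric]) simp
  also have "\<dots> \<le> (\<Sum>j<N. \<Sum>k<N. h (real j - real k))"
    unfolding h_def by (intro order_trans[OF norm_sum] sum_mono) simp
  also have "\<dots> \<le> (\<Sum>j<N. 1 + 2 * (\<Sum>i=1..N. h i))"
  proof (rule sum_mono)
    fix j assume "j \<in> {..<N}"
    then have j: "j < N" by simp
    have split: "{..<N} = {..<j} \<union> ({j} \<union> {j<..<N})"
      using j by auto
    have "(\<Sum>k<N. h (real j - real k)) =
        (\<Sum>k<j. h (real j - real k)) + (\<Sum>k\<in>{j} \<union> {j<..<N}. h (real j - real k))"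
      unfolding split by (rule sum.union_disjoint) auto
    also have "(\<Sum>k\<in>{j} \<union> {j<..<N}. h (real j - real k)) =
        h 0 + (\<Sum>k\<in>{j<..<N}. h (real j - real k))"
      by (subst sum.union_disjoint) auto
    also have "(\<Sum>k<j. h (real j - real k)) = (\<Sum>i=1..j. h i)"
      by (rule sum.reindex_bij_witness[of _ "\<lambda>i. j - i" "\<lambda>k. j - k"]) (auto simp: of_nat_diff)
    also have "\<dots> \<le> (\<Sum>i=1..N. h i)"
      using j by (intro sum_mono2) (auto simp: h_nonneg)
    also have "(\<Sum>k\<in>{j<..<N}. h (real j - real k)) = (\<Sum>i=1..<N - j. h i)"
    proof (rule sum.reindex_bij_witness[of _ "\<lambda>i. i + j" "\<lambda>k. k - j"])
      fix k assume "k \<in> {j<..<N}"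
      then show "h (real (k - j)) = h (real j - real k)"
        using h_minus[of "real j - real k"] by (simp add: of_nat_diff)
    qed auto
    also have "\<dots> \<le> (\<Sum>i=1..N. h i)"
      by (intro sum_mono2) (auto simp: h_nonneg)
    finally show "(\<Sum>k<N. h (real j - real k)) \<le> 1 + 2 * (\<Sum>i=1..N. h i)"
      by (simp add: h_0)
  qed
  finally have upper: "(\<integral>\<omega>. (cmod (E \<omega>))\<^sup>2 \<partial>M) \<le> N * (1 + 2 * (\<Sum>i=1..N. h i))"
    by simp
  have bound: "cmod (E \<omega>) \<le> N" for \<omega>
    unfolding E_def by (rule order_trans[OF norm_sum]) simp
  have "(real N / 2)\<^sup>2 * prob {\<omega> \<in> space M. \<bar>Y \<omega>\<bar> \<le> r} =
      (\<integral>\<omega>. (real N / 2)\<^sup>2 * indicator {\<omega> \<in> space M. \<bar>Y \<omega>\<bar> \<le> r} \<omega> \<partial>M)"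
    by simp
  also have "\<dots> \<le> (\<integral>\<omega>. (cmod (E \<omega>))\<^sup>2 \<partial>M)"
  proof (rule integral_mono)
    show "integrable M (\<lambda>\<omega>. (real N / 2)\<^sup>2 * indicator {\<omega> \<in> space M. \<bar>Y \<omega>\<bar> \<le> r} \<omega>)"
      by (intro integrable_mult_right integrable_real_indicator) (auto simp: emeasure_eq_measure)
    show "integrable M (\<lambda>\<omega>. (cmod (E \<omega>))\<^sup>2)"
      using bound by (intro integrable_const_bound[where B = "(real N)\<^sup>2"]) (auto intro!: power_mono)
    show "(real N / 2)\<^sup>2 * indicator {\<omega> \<in> space M. \<bar>Y \<omega>\<bar> \<le> r} \<omega> \<le> (cmod (E \<omega>))\<^sup>2" for \<omega>
    proof (cases "\<omega> \<in> space M \<and> \<bar>Y \<omega>\<bar> \<le> r")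
      case True
      have "real N / 2 = (\<Sum>j<N. 1 / 2)" by simp
      also have "\<dots> \<le> (\<Sum>j<N. cos (j * \<delta> * Y \<omega>))"
      proof (intro sum_mono cos_ge_half)
        fix j assume "j \<in> {..<N}"
        then have "\<bar>real j * \<delta> * Y \<omega>\<bar> \<le> N * \<delta> * r"
          using True \<delta> unfolding abs_mult by (intro mult_mono) auto
        also have "\<dots> = 1"
          using assms by (simp add: \<delta>_def)
        finally show "\<bar>real j * \<delta> * Y \<omega>\<bar> \<le> 1" .
      qed
      also have "\<dots> = Re (E \<omega>)"
        by (simp add: E_def Re_exp)
      also have "\<dots> \<le> cmod (E \<omega>)" by (rule complex_Re_le_cmod)
      finally show ?thesis
        using True by (simp add: power_mono)
    qed auto
  qed
  finally have "(real N / 2)\<^sup>2 * prob {\<omega> \<in> space M. \<bar>Y \<omega>\<bar> \<le> r} \<le> N * (1 + 2 * (\<Sum>i=1..N. h i))"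
    using upper by simp
  then have "real N * (real N * prob {\<omega> \<in> space M. \<bar>Y \<omega>\<bar> \<le> r}) \<le> real N * (4 + 8 * (\<Sum>i=1..N. h i))"
    by (simp add: algebra_simps power2_eq_square)
  then have "real N * prob {\<omega> \<in> space M. \<bar>Y \<omega>\<bar> \<le> r} \<le> 4 + 8 * (\<Sum>i=1..N. h i)"
    by (rule mult_left_le_imp_le) (use assms in simp)
  then have "prob {\<omega> \<in> space M. \<bar>Y \<omega>\<bar> \<le> r} \<le> 4 / N + 8 / N * (\<Sum>i=1..N. h i)"
    using assms by (simp add: field_simps)
  then show ?thesis by (simp add: h_def \<delta>_def)
qed

text \<open>
  In the previous inequality the term \<open>4 / N\<close> stems from the frequency \<open>0\<close>; the remaining ones
  form a Riemann sum of \<open>\<theta> powr - (\<alpha> * p)\<close>, which is integrable at \<open>0\<close> when \<open>\<alpha> * p < 1\<close>. The result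
  follows as \<open>N\<close> tends to infinity.
\<close>

lemma (in prob_space) prob_abs_le_of_char_decay:
  fixes Y :: "'a \<Rightarrow> real"
  assumes Y: "Y \<in> borel_measurable M" and pos: "0 < c" "0 < \<alpha>" "0 < p" "0 < r" and q: "\<alpha> * p < 1"
    and decay: "\<And>\<theta>. 0 < \<theta> \<Longrightarrow> \<theta> \<le> 1 / r \<Longrightarrow> cmod (char (distr M borel Y) \<theta>) \<le> exp (- (c * \<theta> powr \<alpha>))"
  shows "prob {\<omega> \<in> space M. \<bar>Y \<omega>\<bar> \<le> r} \<le> 8 / (1 - \<alpha> * p) * (p * r powr \<alpha> / c) powr p"
proof -
  let ?P = "prob {\<omega> \<in> space M. \<bar>Y \<omega>\<bar> \<le> r}" and ?B = "8 / (1 - \<alpha> * p) * (p * r powr \<alpha> / c) powr p"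
  have "?P \<le> 4 / real N + ?B" if N: "0 < N" for N :: nat
  proof -
    let ?b = "(p * r powr \<alpha> / c) powr p"
    have term_le: "cmod (char (distr M borel Y) (i * (1 / (r * N)))) \<le> ?b * N powr (\<alpha> * p) * i powr - (\<alpha> * p)"
      if i: "i \<in> {1..N}" for i
    proof -
      let ?\<theta> = "i * (1 / (r * N))"
      have "cmod (char (distr M borel Y) ?\<theta>) \<le> exp (- (c * ?\<theta> powr \<alpha>))"
        using i N pos by (intro decay) (auto simp: field_simps)
      also have "\<dots> \<le> (p / (c * ?\<theta> powr \<alpha>)) powr p"
        using i N pos by (intro exp_minus_le_powr) auto
      also have "p / (c * ?\<theta> powr \<alpha>) = (p * r powr \<alpha> / c) * (N powr \<alpha> * i powr - \<alpha>)"
        using i N pos by (simp add: powr_divide powr_mult powr_minus field_simps)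
      also have "\<dots> powr p = ?b * N powr (\<alpha> * p) * i powr - (\<alpha> * p)"
        using i N pos by (subst powr_mult; simp add: powr_mult powr_powr)
      finally show ?thesis .
    qed
    have "?P \<le> 4 / N + 8 / N * (\<Sum>i=1..N. cmod (char (distr M borel Y) (i * (1 / (r * N)))))"
      using Y pos N by (intro prob_abs_le_char_sum) auto
    also have "\<dots> \<le> 4 / N + 8 / N * (\<Sum>i=1..N. ?b * N powr (\<alpha> * p) * i powr - (\<alpha> * p))"
      by (intro add_left_mono mult_left_mono sum_mono term_le) auto
    also have "(\<Sum>i=1..N. ?b * N powr (\<alpha> * p) * i powr - (\<alpha> * p)) =
        ?b * N powr (\<alpha> * p) * (\<Sum>i=1..N. i powr - (\<alpha> * p))"
      by (simp add: sum_distrib_left)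
    also have "4 / N + 8 / N * \<dots> \<le> 4 / N + 8 / N * (?b * N powr (\<alpha> * p) * (N powr (1 - \<alpha> * p) / (1 - \<alpha> * p)))"
      using pos q by (intro add_left_mono mult_left_mono sum_powr_neg_le) auto
    also have "8 / N * (?b * N powr (\<alpha> * p) * (N powr (1 - \<alpha> * p) / (1 - \<alpha> * p))) = ?B"
      using N q by (simp add: powr_diff field_simps)
    finally show ?thesis .
  qed
  moreover have "(\<lambda>N. 4 / real N + ?B) \<longlonglongrightarrow> 0 + ?B"
    by (intro tendsto_intros lim_const_over_n)
  ultimately show ?thesis
    by (intro LIMSEQ_le_const[of _ "?B"]) (auto intro!: exI[of _ 1])
qed

text \<open>
  Characteristic functions converge along converging arguments as well. By Skorohod's
  representation the laws may be realised by almost surely converging variables, and then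
  dominated convergence applies.
\<close>

lemma char_moving_tendsto:
  assumes \<nu>: "\<And>n. real_distribution (\<nu> n)" and \<mu>: "real_distribution \<mu>" and conv: "weak_conv_m \<nu> \<mu>"
    and n: "filterlim n at_top sequentially" and t: "t \<longlonglongrightarrow> t0"
  shows "(\<lambda>j::nat. char (\<nu> (n j)) (t j)) \<longlonglongrightarrow> char \<mu> t0"
proof -
  from Skorohod[OF \<nu> \<mu> conv] obtain \<Omega> :: "real measure" and Z Z0 where Z:
    "prob_space \<Omega> \<and> (\<forall>n. Z n \<in> borel_measurable \<Omega>) \<and> (\<forall>n. distr \<Omega> borel (Z n) = \<nu> n) \<and>
     Z0 \<in> measurable \<Omega> lborel \<and> distr \<Omega> borel Z0 = \<mu> \<and>
     (\<forall>x\<in>space \<Omega>. (\<lambda>n. Z n x) \<longlonglongrightarrow> Z0 x)"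
    by (elim exE)
  then have "prob_space \<Omega>" and meas: "\<And>n. Z n \<in> borel_measurable \<Omega>" "Z0 \<in> borel_measurable \<Omega>"
    and distr: "\<And>n. distr \<Omega> borel (Z n) = \<nu> n" "distr \<Omega> borel Z0 = \<mu>"
    and lim: "\<And>x. x \<in> space \<Omega> \<Longrightarrow> (\<lambda>n. Z n x) \<longlonglongrightarrow> Z0 x"
    by simp_all
  interpret prob_space \<Omega> by fact
  note [measurable] = meas
  have "(\<lambda>j. \<integral>x. iexp (t j * Z (n j) x) \<partial>\<Omega>) \<longlonglongrightarrow> (\<integral>x. iexp (t0 * Z0 x) \<partial>\<Omega>)"
  proof (rule integral_dominated_convergence[where w = "\<lambda>_. 1"])
    have "(\<lambda>j. Z (n j) x) \<longlonglongrightarrow> Z0 x" if "x \<in> space \<Omega>" for x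
      using filterlim_compose[OF lim[OF that] n] .
    then show "AE x in \<Omega>. (\<lambda>j. iexp (t j * Z (n j) x)) \<longlonglongrightarrow> iexp (t0 * Z0 x)"
      by (intro AE_I2 tendsto_intros t) auto
  qed auto
  moreover have "char (\<nu> k) s = (\<integral>x. iexp (s * Z k x) \<partial>\<Omega>)" for k s
    unfolding distr(1)[symmetric] char_def by (simp add: integral_distr)
  moreover have "char \<mu> s = (\<integral>x. iexp (s * Z0 x) \<partial>\<Omega>)" for s
    unfolding distr(2)[symmetric] char_def by (simp add: integral_distr)
  ultimately show ?thesis by simp
qed

section \<open>Random walks with independent identically distributed steps\<close>

locale iid_walk = prob_space M for M :: "'a measure" +
  fixes X :: "nat \<Rightarrow> 'a \<Rightarrow> int"
  assumes steps_indep: "indep_vars (\<lambda>_. count_space UNIV) X {1..}"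
    and steps_ident: "\<And>k. 1 \<le> k \<Longrightarrow>
      distr M (count_space UNIV) (X k) = distr M (count_space UNIV) (X 1)"
begin

abbreviation S :: "nat \<Rightarrow> 'a \<Rightarrow> int" where
  "S \<equiv> walk X"

text \<open>
  Trajectories are cut at a finite horizon: an integer-valued function on a finite set has
  countably many values, so every predicate on trajectories defines an event.
\<close>

abbreviation traj :: "nat \<Rightarrow> 'a \<Rightarrow> nat \<Rightarrow> int" where
  "traj N \<omega> \<equiv> (\<lambda>m\<in>{..N}. S m \<omega>)"

abbreviation traj_from :: "nat \<Rightarrow> nat \<Rightarrow> 'a \<Rightarrow> nat \<Rightarrow> int" where
  "traj_from i N \<omega> \<equiv> (\<lambda>m\<in>{..N}. S (i + m) \<omega> - S i \<omega>)"

lemma measurable_step: "1 \<le> k \<Longrightarrow> X k \<in> measurable M (count_space UNIV)"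
  using steps_indep by (auto simp: indep_vars_def)

definition steps :: "nat set \<Rightarrow> 'a \<Rightarrow> nat \<Rightarrow> int" where
  "steps I \<omega> = (\<lambda>k\<in>I. X k \<omega>)"

lemma measurable_steps:
  assumes "finite I" "I \<subseteq> {1..}"
  shows "steps I \<in> measurable M (count_space (PiE I (\<lambda>_. UNIV)))"
proof -
  have "steps I \<in> measurable M (PiM I (\<lambda>_. count_space UNIV))"
    unfolding steps_def using assms measurable_step by (intro measurable_restrict) auto
  then show ?thesis
    using assms by (subst (asm) count_space_PiM_finite) auto
qed

lemma indep_var_steps:
  assumes "finite I" "finite J" "I \<subseteq> {1..}" "J \<subseteq> {1..}" "I \<inter> J = {}"
  shows "indep_var (count_space (PiE I (\<lambda>_. UNIV))) (steps I) (count_space (PiE J (\<lambda>_. UNIV))) (steps J)"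
proof -
  have "indep_var (PiM I (\<lambda>_. count_space UNIV)) (steps I) (PiM J (\<lambda>_. count_space UNIV)) (steps J)"
    using indep_var_restrict[OF steps_indep assms(5,3,4)] by (simp add: steps_def[abs_def])
  then show ?thesis
    using assms(1,2) by (simp add: count_space_PiM_finite)
qed

lemma indep_vars_shift: "indep_vars (\<lambda>_. count_space UNIV) (\<lambda>k. X (i + k)) {1..}"
  unfolding indep_vars_def2
proof (intro conjI ballI)
  show "X (i + k) \<in> measurable M (count_space UNIV)" if "k \<in> {1..}" for k
    using that by (intro measurable_step) auto
  have ind: "indep_sets (\<lambda>k. {X k -` A \<inter> space M |A. A \<in> sets (count_space UNIV)}) {1..}"
    using steps_indep by (simp add: indep_vars_def2)
  show "indep_sets (\<lambda>k. {X (i + k) -` A \<inter> space M |A. A \<in> sets (count_space UNIV)}) {1..}"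
  proof (rule indep_setsI)
    show "{X (i + k) -` A \<inter> space M |A. A \<in> sets (count_space UNIV)} \<subseteq> events" if "k \<in> {1..}" for k
      using that measurable_step[of "i + k"] by (auto intro: measurable_sets)
    fix A J assume J: "J \<noteq> {}" "J \<subseteq> {1..}" "finite J"
      and A: "\<forall>j\<in>J. A j \<in> {X (i + j) -` A \<inter> space M |A. A \<in> sets (count_space UNIV)}"
    have inj: "inj_on ((+) i) J" by simp
    have "prob (\<Inter>j\<in>(+) i ` J. A (j - i)) = (\<Prod>j\<in>(+) i ` J. prob (A (j - i)))"
      using J A by (intro indep_setsD[OF ind]) auto
    then show "prob (\<Inter>j\<in>J. A j) = (\<Prod>j\<in>J. prob (A j))"
      by (simp add: prod.reindex)
  qed
qed

lemma distr_shift: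
  "distr M (PiM {1..N} (\<lambda>_. count_space UNIV)) (\<lambda>\<omega>. \<lambda>k\<in>{1..N}. X (i + k) \<omega>) =
   distr M (PiM {1..N} (\<lambda>_. count_space UNIV)) (steps {1..N})"
proof (cases "N = 0")
  case True
  then show ?thesis by (simp add: steps_def[abs_def] restrict_def)
next
  case False
  then have ne: "{1..N} \<noteq> {}" by simp
  have "distr M (PiM {1..N} (\<lambda>_. count_space UNIV)) (\<lambda>\<omega>. \<lambda>k\<in>{1..N}. X (i + k) \<omega>) =
      PiM {1..N} (\<lambda>k. distr M (count_space UNIV) (X 1))" for i
  proof -
    have "indep_vars (\<lambda>_. count_space UNIV) (\<lambda>k. X (i + k)) {1..N}"
      by (rule indep_vars_subset[OF indep_vars_shift]) auto
    moreover have "X (i + k) \<in> measurable M (count_space UNIV)" if "k \<in> {1..N}" for k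
      using that by (intro measurable_step) auto
    ultimately have "distr M (PiM {1..N} (\<lambda>_. count_space UNIV)) (\<lambda>\<omega>. \<lambda>k\<in>{1..N}. X (i + k) \<omega>) =
        PiM {1..N} (\<lambda>k. distr M (count_space UNIV) (X (i + k)))"
      by (subst (asm) indep_vars_iff_distr_eq_PiM'[OF ne]) auto
    also have "\<dots> = PiM {1..N} (\<lambda>k. distr M (count_space UNIV) (X 1))"
      by (intro PiM_cong refl steps_ident) auto
    finally show ?thesis .
  qed
  from this[of i] this[of 0] show ?thesis
    by (simp add: steps_def[abs_def])
qed

definition partial_sums :: "nat \<Rightarrow> nat \<Rightarrow> (nat \<Rightarrow> int) \<Rightarrow> nat \<Rightarrow> int" where
  "partial_sums i N x = (\<lambda>m\<in>{..N}. \<Sum>k=1..m. x (i + k))"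

lemma traj_eq: "traj N \<omega> = partial_sums 0 N (steps {1..N} \<omega>)"
  by (auto simp: fun_eq_iff partial_sums_def steps_def walk_def restrict_def intro!: sum.cong)

lemma traj_from_eq_shift: "traj_from i N \<omega> = partial_sums 0 N (\<lambda>k\<in>{1..N}. X (i + k) \<omega>)"
proof -
  have "S (i + m) \<omega> - S i \<omega> = (\<Sum>k=1..m. X (i + k) \<omega>)" for m
  proof -
    have "S (i + m) \<omega> = S i \<omega> + (\<Sum>k=i+1..i+m. X k \<omega>)"
      unfolding walk_def by (rule sum.ub_add_nat) simp
    also have "(\<Sum>k=i+1..i+m. X k \<omega>) = (\<Sum>k=1..m. X (i + k) \<omega>)"
      by (rule sum.reindex_bij_witness[of _ "\<lambda>k. i + k" "\<lambda>k. k - i"]) auto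
    finally show ?thesis by simp
  qed
  then show ?thesis
    by (auto simp: fun_eq_iff partial_sums_def restrict_def intro!: sum.cong)
qed

lemma traj_from_eq: "traj_from i N \<omega> = partial_sums i N (steps {i+1..i+N} \<omega>)"
  unfolding traj_from_eq_shift
  by (auto simp: fun_eq_iff partial_sums_def steps_def restrict_def intro!: sum.cong)

lemma measurable_traj: "(\<lambda>\<omega>. f (traj N \<omega>)) \<in> measurable M (count_space UNIV)"
  unfolding traj_eq by (rule measurable_compose[OF measurable_steps]) auto

lemma measurable_walk [measurable]: "S n \<in> measurable M (count_space UNIV)"
  using measurable_traj[of "\<lambda>x. x n" n] by simp

text \<open>
  The walk restarted at time \<open>i\<close> is a copy of the walk.
\<close>

lemma prob_traj_from: "prob {\<omega> \<in> space M. R (traj_from i N \<omega>)} = prob {\<omega> \<in> space M. R (traj N \<omega>)}"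
proof -
  let ?P = "PiM {1..N} (\<lambda>_. count_space UNIV) :: (nat \<Rightarrow> int) measure"
  let ?A = "{x \<in> space ?P. R (partial_sums 0 N x)}"
  have P: "?P = count_space (PiE {1..N} (\<lambda>_. UNIV))"
    by (rule count_space_PiM_finite) auto
  have A: "?A \<in> sets ?P"
    unfolding P by auto
  have eq: "measure (distr M ?P Y) ?A = prob {\<omega> \<in> space M. R (partial_sums 0 N (Y \<omega>))}"
    if "Y \<in> measurable M ?P" for Y
    using that measurable_space[OF that]
    by (subst measure_distr[OF that A]) (auto intro!: arg_cong[where f = prob])
  have 1: "(\<lambda>\<omega>. \<lambda>k\<in>{1..N}. X (i + k) \<omega>) \<in> measurable M ?P"
    by (intro measurable_restrict measurable_step) auto
  have 2: "steps {1..N} \<in> measurable M ?P"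
    unfolding P by (rule measurable_steps) auto
  show ?thesis
    unfolding traj_from_eq_shift traj_eq eq[OF 1, symmetric] eq[OF 2, symmetric] distr_shift ..
qed

lemma indep_traj_from:
  "indep_var (count_space UNIV) (\<lambda>\<omega>. f (traj i \<omega>)) (count_space UNIV) (\<lambda>\<omega>. g (traj_from i N \<omega>))"
proof -
  have "indep_var (count_space UNIV) ((\<lambda>x. f (partial_sums 0 i x)) \<circ> steps {1..i})
      (count_space UNIV) ((\<lambda>x. g (partial_sums i N x)) \<circ> steps {i+1..i+N})"
    by (rule indep_var_compose[OF indep_var_steps]) auto
  then show ?thesis
    by (simp add: traj_eq traj_from_eq comp_def)
qed

text \<open>
  Together with the equality in law this is the Markov property at a fixed time.
\<close>

lemma prob_traj_indep:
  "prob {\<omega> \<in> space M. P (traj i \<omega>) \<and> R (traj_from i N \<omega>)} =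
   prob {\<omega> \<in> space M. P (traj i \<omega>)} * prob {\<omega> \<in> space M. R (traj N \<omega>)}"
proof -
  have "prob ((\<lambda>\<omega>. (P (traj i \<omega>), R (traj_from i N \<omega>))) -` ({True} \<times> {True}) \<inter> space M) =
      prob ((\<lambda>\<omega>. P (traj i \<omega>)) -` {True} \<inter> space M) * prob ((\<lambda>\<omega>. R (traj_from i N \<omega>)) -` {True} \<inter> space M)"
    by (rule indep_varD[OF indep_traj_from]) auto
  then show ?thesis
    by (simp add: vimage_def Int_def conj_commute prob_traj_from[of R i N])
qed

end

text \<open>
  A maximal inequality of Ottaviani type. At the first time \<open>s\<close> in \<open>{t..t+L}\<close> at which
  the walk is within \<open>x\<close> of the origin, the rest of the path up to time \<open>t + L\<close> moves by at most \<open>K\<close> with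
  probability at least \<open>1 / 2\<close>, independently of the past; then the walk ends within \<open>x + K\<close> of the origin.
\<close>

lemma (in iid_walk) prob_hit_le:
  assumes half: "\<And>m. m \<le> L \<Longrightarrow> 1 / 2 \<le> prob {\<omega> \<in> space M. \<bar>real_of_int (S m \<omega>)\<bar> \<le> K}"
  shows "prob {\<omega> \<in> space M. \<exists>m\<in>{t..t+L}. \<bar>real_of_int (S m \<omega>)\<bar> \<le> x} \<le>
    2 * prob {\<omega> \<in> space M. \<bar>real_of_int (S (t + L) \<omega>)\<bar> \<le> x + K}"
proof -
  define P where "P s f \<longleftrightarrow> \<bar>real_of_int (f s)\<bar> \<le> x \<and> (\<forall>m\<in>{t..<s}. \<not> \<bar>real_of_int (f m)\<bar> \<le> x)" for s and f :: "nat \<Rightarrow> int"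
  define A where "A s = {\<omega> \<in> space M. P s (\<lambda>m. S m \<omega>)}" for s
  define B where "B s = {\<omega> \<in> space M. P s (\<lambda>m. S m \<omega>) \<and> \<bar>real_of_int (S (t + L) \<omega> - S s \<omega>)\<bar> \<le> K}" for s
  have P_traj: "P s (traj s \<omega>) = P s (\<lambda>m. S m \<omega>)" for s \<omega>
    by (auto simp: P_def)
  have [measurable]: "Measurable.pred M (\<lambda>\<omega>. P s (\<lambda>m. S m \<omega>))" for s
    unfolding P_def by measurable
  have [measurable]: "A s \<in> events" "B s \<in> events" for s
    unfolding A_def B_def by measurable
  have less: "\<not> (P r f \<and> P s f)" if "t \<le> r" "r < s" for r s f
    using that unfolding P_def by (meson atLeastLessThan_iff)
  have first_unique: "r = s" if "P r f" "P s f" "t \<le> r" "t \<le> s" for r s f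
    using less[of r s f] less[of s r f] that by linarith
  have "A r \<inter> A s = {}" "B r \<inter> B s = {}" if rs: "r \<in> {t..t+L}" "s \<in> {t..t+L}" "r \<noteq> s" for r s
  proof -
    have "False" if "P r f" "P s f" for f
      using first_unique[OF that] rs by simp
    then show "A r \<inter> A s = {}" "B r \<inter> B s = {}"
      unfolding A_def B_def by blast+
  qed
  then have disj: "disjoint_family_on A {t..t+L}" "disjoint_family_on B {t..t+L}"
    unfolding disjoint_family_on_def by blast+
  have "{\<omega> \<in> space M. \<exists>m\<in>{t..t+L}. \<bar>real_of_int (S m \<omega>)\<bar> \<le> x} \<subseteq> (\<Union>s\<in>{t..t+L}. A s)"
  proof
    fix \<omega> assume \<omega>: "\<omega> \<in> {\<omega> \<in> space M. \<exists>m\<in>{t..t+L}. \<bar>real_of_int (S m \<omega>)\<bar> \<le> x}"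
    define Q where "Q m \<longleftrightarrow> m \<in> {t..t+L} \<and> \<bar>real_of_int (S m \<omega>)\<bar> \<le> x" for m
    define s where "s = (LEAST m. Q m)"
    have "\<exists>m. Q m"
      using \<omega> by (auto simp: Q_def)
    then have "Q s"
      unfolding s_def by (rule LeastI_ex)
    moreover have "\<not> Q m" if "m < s" for m
      using that unfolding s_def by (rule not_less_Least)
    ultimately show "\<omega> \<in> (\<Union>s\<in>{t..t+L}. A s)"
      using \<omega> by (fastforce simp: A_def P_def Q_def)
  qed
  then have "prob {\<omega> \<in> space M. \<exists>m\<in>{t..t+L}. \<bar>real_of_int (S m \<omega>)\<bar> \<le> x} \<le> prob (\<Union>s\<in>{t..t+L}. A s)"
    by (intro finite_measure_mono) auto
  also have "\<dots> = (\<Sum>s\<in>{t..t+L}. prob (A s))"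
    using disj by (intro finite_measure_finite_Union) auto
  also have "\<dots> \<le> (\<Sum>s\<in>{t..t+L}. 2 * prob (B s))"
  proof (rule sum_mono)
    fix s assume s: "s \<in> {t..t+L}"
    define N where "N = t + L - s"
    have N: "s + N = t + L" "N \<le> L"
      using s by (auto simp: N_def)
    have "prob (B s) = prob {\<omega> \<in> space M. P s (traj s \<omega>) \<and> \<bar>real_of_int (traj_from s N \<omega> N)\<bar> \<le> K}"
      unfolding B_def P_traj by (simp add: N)
    also have "\<dots> = prob {\<omega> \<in> space M. P s (traj s \<omega>)} * prob {\<omega> \<in> space M. \<bar>real_of_int (traj N \<omega> N)\<bar> \<le> K}"
      by (rule prob_traj_indep)
    also have "\<dots> = prob (A s) * prob {\<omega> \<in> space M. \<bar>real_of_int (S N \<omega>)\<bar> \<le> K}"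
      unfolding A_def P_traj by simp
    finally have "prob (B s) = prob (A s) * prob {\<omega> \<in> space M. \<bar>real_of_int (S N \<omega>)\<bar> \<le> K}" .
    moreover have "prob (A s) * (1 / 2) \<le> prob (A s) * prob {\<omega> \<in> space M. \<bar>real_of_int (S N \<omega>)\<bar> \<le> K}"
      using half[OF N(2)] by (intro mult_left_mono) auto
    ultimately show "prob (A s) \<le> 2 * prob (B s)" by simp
  qed
  also have "\<dots> = 2 * prob (\<Union>s\<in>{t..t+L}. B s)"
    using disj by (subst finite_measure_finite_Union) (auto simp: sum_distrib_left)
  also have "prob (\<Union>s\<in>{t..t+L}. B s) \<le> prob {\<omega> \<in> space M. \<bar>real_of_int (S (t + L) \<omega>)\<bar> \<le> x + K}"
    by (intro finite_measure_mono) (auto simp: B_def P_def)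
  finally show ?thesis by simp
qed

section \<open>Walks attracted to a stable law of index below one\<close>

locale stable_walk = iid_walk +
  fixes \<alpha> C1 C2 :: real and \<mu> :: "real measure"
  assumes stable: "stable_law \<alpha> C1 C2 \<mu>"
    and index_less_1: "\<alpha> < 1"
    and cdf_conv: "\<And>x. (\<lambda>n. prob {\<omega> \<in> space M. real_of_int (S n \<omega>) / real n powr (1 / \<alpha>) \<le> x}) \<longlonglongrightarrow> cdf \<mu> x"
begin

lemma index_pos: "0 < \<alpha>" and C1_pos: "0 < C1" and limit_distribution: "real_distribution \<mu>"
  using stable by (auto simp: stable_law_def)

lemma cmod_char_limit: "cmod (char \<mu> 1) = exp (- C1)"
  using stable by (simp add: stable_law_def)

definition step_char :: "real \<Rightarrow> complex" where
  "step_char = char (distr M borel (\<lambda>\<omega>. real_of_int (X 1 \<omega>)))"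

lemma measurable_real_walk [measurable]: "(\<lambda>\<omega>. real_of_int (S n \<omega>)) \<in> borel_measurable M"
  by (rule measurable_compose[OF measurable_walk]) simp

lemma char_walk: "char (distr M borel (\<lambda>\<omega>. real_of_int (S n \<omega>))) \<theta> = step_char \<theta> ^ n"
proof -
  have char_step: "char (distr M borel (\<lambda>\<omega>. real_of_int (X k \<omega>))) \<theta> = step_char \<theta>" if "k \<in> {1..n}" for k
  proof -
    have "distr M borel (\<lambda>\<omega>. real_of_int (X k \<omega>)) = distr (distr M (count_space UNIV) (X k)) borel real_of_int"
      if "1 \<le> k" for k
      using measurable_step[OF that] by (subst distr_distr) (auto simp: comp_def)
    then show ?thesis
      using that steps_ident[of k] by (simp add: step_char_def)
  qed
  have "indep_vars (\<lambda>_. borel) (\<lambda>k \<omega>. real_of_int (X k \<omega>)) {1..n}"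
    by (rule indep_vars_compose2[OF indep_vars_subset[OF steps_indep]]) auto
  from char_distr_sum[OF this, of \<theta>] show ?thesis
    by (simp add: walk_def char_step)
qed

text \<open>
  Frequencies of the order \<open>n powr - (1 / \<alpha>)\<close> see the limit law; the argument of the limiting
  characteristic function is normalised to \<open>1\<close>.
\<close>

lemma scaled_char_tendsto:
  assumes n: "filterlim n at_top sequentially" and t: "(\<lambda>j. \<theta> j * real (n j) powr (1 / \<alpha>)) \<longlonglongrightarrow> 1"
  shows "(\<lambda>j. cmod (step_char (\<theta> j)) ^ n j) \<longlonglongrightarrow> exp (- C1)"
proof -
  define Z where "Z n \<omega> = real_of_int (S n \<omega>) / real n powr (1 / \<alpha>)" for n \<omega>
  have [measurable]: "Z n \<in> borel_measurable M" for n
    unfolding Z_def by measurable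
  have dist: "real_distribution (distr M borel (Z n))" for n
    by (simp add: real_distribution_distr)
  have "cdf (distr M borel (Z n)) x = prob {\<omega> \<in> space M. real_of_int (S n \<omega>) / real n powr (1 / \<alpha>) \<le> x}" for n x
    unfolding cdf_def by (subst measure_distr) (auto simp: Z_def intro!: arg_cong[where f = prob])
  then have "weak_conv_m (\<lambda>n. distr M borel (Z n)) \<mu>"
    using cdf_conv by (simp add: weak_conv_m_def weak_conv_def)
  then have "(\<lambda>j. cmod (char (distr M borel (Z (n j))) (\<theta> j * real (n j) powr (1 / \<alpha>)))) \<longlonglongrightarrow> cmod (char \<mu> 1)"
    using dist limit_distribution n t by (intro tendsto_norm char_moving_tendsto) auto
  then have lim: "(\<lambda>j. cmod (char (distr M borel (Z (n j))) (\<theta> j * real (n j) powr (1 / \<alpha>)))) \<longlonglongrightarrow> exp (- C1)"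
    by (simp add: cmod_char_limit)
  have "char (distr M borel (Z k)) (x * real k powr (1 / \<alpha>)) = step_char x ^ k" if "0 < k" for k x
  proof -
    have "char (distr M borel (Z k)) (x * real k powr (1 / \<alpha>)) =
        (CLINT \<omega>|M. iexp (x * real k powr (1 / \<alpha>) * Z k \<omega>))"
      unfolding char_def by (subst integral_distr) auto
    also have "\<dots> = (CLINT \<omega>|M. iexp (x * real_of_int (S k \<omega>)))"
      using that by (simp add: Z_def)
    also have "\<dots> = char (distr M borel (\<lambda>\<omega>. real_of_int (S k \<omega>))) x"
      unfolding char_def by (subst integral_distr) auto
    finally show ?thesis by (simp add: char_walk)
  qed
  moreover have "eventually (\<lambda>j. 0 < n j) sequentially"
    using n[unfolded filterlim_at_top, rule_format, of 1] by (auto elim: eventually_mono)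
  ultimately have "eventually (\<lambda>j. cmod (char (distr M borel (Z (n j))) (\<theta> j * real (n j) powr (1 / \<alpha>))) =
      cmod (step_char (\<theta> j)) ^ n j) sequentially"
    by (auto elim!: eventually_mono simp: norm_power)
  then show ?thesis
    by (rule Lim_transform_eventually[OF lim])
qed

text \<open>
  For small \<open>\<theta>\<close> take \<open>n\<close> to be \<open>\<theta> powr - \<alpha>\<close> rounded up. Then \<open>\<theta> * n powr (1 / \<alpha>)\<close> is close to \<open>1\<close>, so
  the \<open>n\<close>-th power of the characteristic function of a step is close in modulus to \<open>exp (- C1) < 1\<close>.
  Taking the \<open>n\<close>-th root gives the decay.
\<close>

lemma char_decay:
  "\<exists>c \<theta>0. 0 < c \<and> 0 < \<theta>0 \<and> (\<forall>\<theta>. 0 < \<theta> \<and> \<theta> \<le> \<theta>0 \<longrightarrow> cmod (step_char \<theta>) \<le> exp (- (c * \<theta> powr \<alpha>)))"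
proof -
  define n where "n \<theta> = nat \<lceil>\<theta> powr - \<alpha>\<rceil>" for \<theta> :: real
  have n_ge: "\<theta> powr - \<alpha> \<le> real (n \<theta>)" and n_le: "real (n \<theta>) \<le> \<theta> powr - \<alpha> + 1" if "0 < \<theta>" for \<theta>
  proof -
    show "\<theta> powr - \<alpha> \<le> real (n \<theta>)"
      unfolding n_def by (rule of_nat_ceiling)
    have "real (n \<theta>) = of_int \<lceil>\<theta> powr - \<alpha>\<rceil>"
      unfolding n_def using powr_ge_zero[of \<theta> "- \<alpha>"] by (intro of_nat_nat) linarith
    then show "real (n \<theta>) \<le> \<theta> powr - \<alpha> + 1"
      using of_int_ceiling_le_add_one[of "\<theta> powr - \<alpha>"] by simp
  qed
  have "eventually (\<lambda>\<theta>. cmod (step_char \<theta>) ^ n \<theta> < exp (- C1 / 2)) (at_right 0)"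
  proof (rule sequentially_imp_eventually_at_right[of 0 1])
    fix f :: "nat \<Rightarrow> real" assume f: "\<And>j. 0 < f j" "f \<longlonglongrightarrow> 0"
    have f': "filterlim f (at_right 0) sequentially"
      using f by (intro tendsto_imp_filterlim_at_right always_eventually) auto
    have "filterlim (\<lambda>j. f j powr - \<alpha>) at_top sequentially"
    proof (rule filterlim_compose[OF _ f'])
      show "filterlim (\<lambda>x. x powr - \<alpha>) at_top (at_right 0)"
        using index_pos by real_asymp
    qed
    then have "\<forall>\<^sub>F j in sequentially. real k \<le> f j powr - \<alpha>" for k
      by (simp add: filterlim_at_top)
    moreover have "k \<le> n (f j)" if "real k \<le> f j powr - \<alpha>" for k j
      using order_trans[OF that n_ge[OF f(1)[of j]]] by simp
    ultimately have "\<forall>\<^sub>F j in sequentially. k \<le> n (f j)" for k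
      by (rule eventually_mono) simp_all
    then have n: "filterlim (\<lambda>j. n (f j)) at_top sequentially"
      by (simp add: filterlim_at_top)
    have lim: "(\<lambda>j. f j powr \<alpha>) \<longlonglongrightarrow> 0"
      using f index_pos by (intro tendsto_zero_powrI[OF f(2) tendsto_const]) (auto simp: less_imp_le)
    have "(\<lambda>j. f j powr \<alpha> * real (n (f j))) \<longlonglongrightarrow> 1"
    proof (rule tendsto_sandwich)
      show "\<forall>\<^sub>F j in sequentially. 1 \<le> f j powr \<alpha> * real (n (f j))"
        using n_ge f by (auto intro!: always_eventually simp: powr_minus field_simps)
      show "\<forall>\<^sub>F j in sequentially. f j powr \<alpha> * real (n (f j)) \<le> 1 + f j powr \<alpha>"
        using n_le f by (auto intro!: always_eventually simp: powr_minus field_simps)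
      show "(\<lambda>j. 1 + f j powr \<alpha>) \<longlonglongrightarrow> 1"
        using tendsto_add[OF tendsto_const[of 1] lim] by simp
    qed auto
    then have "(\<lambda>j. (f j powr \<alpha> * real (n (f j))) powr (1 / \<alpha>)) \<longlonglongrightarrow> 1 powr (1 / \<alpha>)"
      by (intro tendsto_intros) auto
    then have "(\<lambda>j. f j * real (n (f j)) powr (1 / \<alpha>)) \<longlonglongrightarrow> 1"
      using index_pos f(1) by (simp add: powr_mult powr_powr less_imp_le abs_of_pos)
    from scaled_char_tendsto[OF n this]
    have "(\<lambda>j. cmod (step_char (f j)) ^ n (f j)) \<longlonglongrightarrow> exp (- C1)" .
    then show "\<forall>\<^sub>F j in sequentially. cmod (step_char (f j)) ^ n (f j) < exp (- C1 / 2)"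
      by (rule order_tendstoD) (use C1_pos in simp)
  qed simp
  then obtain b where b: "0 < b" "\<And>\<theta>. 0 < \<theta> \<Longrightarrow> \<theta> < b \<Longrightarrow> cmod (step_char \<theta>) ^ n \<theta> < exp (- C1 / 2)"
    unfolding eventually_at_right_field by blast
  show ?thesis
  proof (rule exI[of _ "C1 / 4"], rule exI[of _ "min (b / 2) 1"], intro conjI allI impI)
    fix \<theta> :: real assume "0 < \<theta> \<and> \<theta> \<le> min (b / 2) 1"
    then have \<theta>: "0 < \<theta>" "\<theta> \<le> min (b / 2) 1" by auto
    have "1 \<le> \<theta> powr - \<alpha>"
      using \<theta> index_pos by (simp add: powr_minus one_le_inverse_iff powr_le1)
    then have n: "0 < real (n \<theta>)" "real (n \<theta>) \<le> 2 * \<theta> powr - \<alpha>"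
      using n_ge[of \<theta>] n_le[of \<theta>] \<theta> by linarith+
    have "cmod (step_char \<theta>) ^ n \<theta> < exp (- C1 / 2)"
      using b \<theta> by auto
    also have "\<dots> = exp (- (C1 / (2 * n \<theta>))) ^ n \<theta>"
      using n by (simp flip: exp_of_nat_mult add: field_simps)
    finally have "cmod (step_char \<theta>) < exp (- (C1 / (2 * n \<theta>)))"
      by (rule power_less_imp_less_base) simp
    also have "\<dots> \<le> exp (- (C1 / 4 * \<theta> powr \<alpha>))"
    proof -
      have "C1 / 4 * \<theta> powr \<alpha> = C1 / (2 * (2 * \<theta> powr - \<alpha>))"
        using \<theta> by (simp add: powr_minus field_simps)
      also have "\<dots> \<le> C1 / (2 * n \<theta>)"
        using n C1_pos \<theta> by (intro divide_left_mono mult_left_mono mult_pos_pos) auto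
      finally show ?thesis by simp
    qed
    finally show "cmod (step_char \<theta>) \<le> exp (- (C1 / 4 * \<theta> powr \<alpha>))" by simp
  qed (use C1_pos b in auto)
qed

text \<open>
  The exponent \<open>p\<close> must exceed \<open>1\<close> for summability over blocks of times later on, and \<open>\<alpha> * p < 1\<close> is
  needed for integrability in the frequency. Both are possible exactly because \<open>\<alpha> < 1\<close>.
\<close>

lemma prob_walk_small:
  "\<exists>C p r0. 0 < C \<and> 1 < p \<and> 0 < r0 \<and> (\<forall>r m. r0 \<le> r \<longrightarrow> 0 < m \<longrightarrow>
    prob {\<omega> \<in> space M. \<bar>real_of_int (S m \<omega>)\<bar> \<le> r} \<le> C * (r powr \<alpha> / real m) powr p)"
proof -
  obtain c \<theta>0 where c: "0 < c" "0 < \<theta>0"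
    and decay: "\<forall>\<theta>. 0 < \<theta> \<and> \<theta> \<le> \<theta>0 \<longrightarrow> cmod (step_char \<theta>) \<le> exp (- (c * \<theta> powr \<alpha>))"
    using char_decay by blast
  (* the midpoint of the admissible interval from 1 to 1 / alpha *)
  define p where "p = (1 + 1 / \<alpha>) / 2"
  have p: "1 < p" "\<alpha> * p < 1"
    using index_pos index_less_1 by (auto simp: p_def field_simps)
  show ?thesis
  proof (rule exI[of _ "8 / (1 - \<alpha> * p) * (p / c) powr p"], rule exI[of _ p], rule exI[of _ "1 / \<theta>0"],
      intro conjI allI impI)
    fix r and m :: nat assume r: "1 / \<theta>0 \<le> r" and m: "0 < m"
    have "0 < r"
      using r c by (intro less_le_trans[OF _ r]) auto
    have "prob {\<omega> \<in> space M. \<bar>real_of_int (S m \<omega>)\<bar> \<le> r} \<le>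
        8 / (1 - \<alpha> * p) * (p * r powr \<alpha> / (c * m)) powr p"
    proof (rule prob_abs_le_of_char_decay)
      fix \<theta> assume \<theta>: "0 < \<theta>" "\<theta> \<le> 1 / r"
      have "1 / r \<le> \<theta>0"
        using r c \<open>0 < r\<close> by (simp add: field_simps)
      then have "cmod (step_char \<theta>) ^ m \<le> exp (- (c * \<theta> powr \<alpha>)) ^ m"
        using \<theta> by (intro power_mono decay[rule_format]) auto
      then show "cmod (char (distr M borel (\<lambda>\<omega>. real_of_int (S m \<omega>))) \<theta>) \<le> exp (- (c * m * \<theta> powr \<alpha>))"
        by (simp add: char_walk norm_power mult_ac flip: exp_of_nat_mult)
    qed (use c p m \<open>0 < r\<close> index_pos in auto)
    also have "p * r powr \<alpha> / (c * m) = (p / c) * (r powr \<alpha> / m)"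
      by simp
    also have "\<dots> powr p = (p / c) powr p * (r powr \<alpha> / m) powr p"
      by (rule powr_mult)
    finally show "prob {\<omega> \<in> space M. \<bar>real_of_int (S m \<omega>)\<bar> \<le> r} \<le>
        8 / (1 - \<alpha> * p) * (p / c) powr p * (r powr \<alpha> / m) powr p"
      by simp
  qed (use c p in auto)
qed

text \<open>
  Weak convergence controls all but finitely many times, and these finitely many are absorbed
  into the constant. The argument \<open>L + 1\<close> keeps the bound meaningful for \<open>L = 0\<close>.
\<close>

lemma walk_tight:
  "\<exists>K\<ge>1. \<forall>m L. m \<le> L \<longrightarrow>
    1 / 2 \<le> prob {\<omega> \<in> space M. \<bar>real_of_int (S m \<omega>)\<bar> \<le> K * real (L + 1) powr (1 / \<alpha>)}"
proof -
  interpret \<mu>: real_distribution \<mu> by (rule limit_distribution)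
  have "((\<lambda>x. cdf \<mu> x - cdf \<mu> (- x)) \<longlongrightarrow> 1 - 0) at_top"
    by (intro tendsto_diff \<mu>.cdf_lim_at_top_prob filterlim_compose[OF \<mu>.cdf_lim_at_bot filterlim_uminus_at_bot_at_top])
  then have "\<forall>\<^sub>F x in at_top. 1 / 2 < cdf \<mu> x - cdf \<mu> (- x)"
    by (rule order_tendstoD) simp
  then have "\<forall>\<^sub>F x in at_top. 1 / 2 < cdf \<mu> x - cdf \<mu> (- x) \<and> 0 < x"
    by (intro eventually_conj eventually_gt_at_top)
  then obtain x where x: "1 / 2 < cdf \<mu> x - cdf \<mu> (- x)" "0 < x"
    using eventually_happens'[OF trivial_limit_at_top_linorder] by blast
  let ?Z = "\<lambda>n \<omega>. real_of_int (S n \<omega>) / real n powr (1 / \<alpha>)"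
  have "(\<lambda>n. prob {\<omega> \<in> space M. ?Z n \<omega> \<le> x} - prob {\<omega> \<in> space M. ?Z n \<omega> \<le> - x})
      \<longlonglongrightarrow> cdf \<mu> x - cdf \<mu> (- x)"
    by (intro tendsto_diff cdf_conv)
  then have "\<forall>\<^sub>F n in sequentially. 1 / 2 < prob {\<omega> \<in> space M. ?Z n \<omega> \<le> x} - prob {\<omega> \<in> space M. ?Z n \<omega> \<le> - x}"
    by (rule order_tendstoD) (rule x)
  then obtain m0 where m0: "\<And>n. m0 \<le> n \<Longrightarrow>
      1 / 2 < prob {\<omega> \<in> space M. ?Z n \<omega> \<le> x} - prob {\<omega> \<in> space M. ?Z n \<omega> \<le> - x}"
    by (auto simp: eventually_sequentially)
  have large: "1 / 2 \<le> prob {\<omega> \<in> space M. \<bar>real_of_int (S n \<omega>)\<bar> \<le> x * real n powr (1 / \<alpha>)}"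
    if "m0 \<le> n" "0 < n" for n
  proof -
    have "prob {\<omega> \<in> space M. ?Z n \<omega> \<le> x} \<le>
        prob ({\<omega> \<in> space M. ?Z n \<omega> \<le> - x} \<union> {\<omega> \<in> space M. \<bar>real_of_int (S n \<omega>)\<bar> \<le> x * real n powr (1 / \<alpha>)})"
      using that by (intro finite_measure_mono) (auto simp: field_simps abs_le_iff)
    also have "\<dots> \<le> prob {\<omega> \<in> space M. ?Z n \<omega> \<le> - x} +
        prob {\<omega> \<in> space M. \<bar>real_of_int (S n \<omega>)\<bar> \<le> x * real n powr (1 / \<alpha>)}"
      by (intro measure_Un_le) auto
    finally show ?thesis using m0[OF that(1)] by simp
  qed
  have "\<exists>y\<ge>0. 1 / 2 \<le> prob {\<omega> \<in> space M. \<bar>real_of_int (S m \<omega>)\<bar> \<le> y}" for m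
  proof -
    have "(\<lambda>n. prob {\<omega> \<in> space M. \<bar>real_of_int (S m \<omega>)\<bar> \<le> real n}) \<longlonglongrightarrow>
        prob (\<Union>n. {\<omega> \<in> space M. \<bar>real_of_int (S m \<omega>)\<bar> \<le> real n})"
      by (intro finite_Lim_measure_incseq) (auto simp: incseq_def)
    also have "(\<Union>n. {\<omega> \<in> space M. \<bar>real_of_int (S m \<omega>)\<bar> \<le> real n}) = space M"
      using real_arch_simple by auto
    finally have "\<forall>\<^sub>F n in sequentially. 1 / 2 < prob {\<omega> \<in> space M. \<bar>real_of_int (S m \<omega>)\<bar> \<le> real n}"
      by (rule order_tendstoD) (simp add: prob_space)
    then obtain n where "1 / 2 < prob {\<omega> \<in> space M. \<bar>real_of_int (S m \<omega>)\<bar> \<le> real n}"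
      using eventually_happens'[OF sequentially_bot] by blast
    then show ?thesis by (intro exI[of _ "real n"]) simp
  qed
  then obtain y where y: "\<And>m. 0 \<le> y m"
      "\<And>m. 1 / 2 \<le> prob {\<omega> \<in> space M. \<bar>real_of_int (S m \<omega>)\<bar> \<le> y m}"
    by metis
  have sum_y: "0 \<le> (\<Sum>m\<le>m0. y m)"
    using y by (intro sum_nonneg) auto
  define K where "K = 1 + x + (\<Sum>m\<le>m0. y m)"
  show ?thesis
  proof (intro exI[of _ K] conjI allI impI)
    show "1 \<le> K"
      using x sum_y by (simp add: K_def)
    fix m L :: nat assume "m \<le> L"
    show "1 / 2 \<le> prob {\<omega> \<in> space M. \<bar>real_of_int (S m \<omega>)\<bar> \<le> K * real (L + 1) powr (1 / \<alpha>)}"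
    proof (cases "m \<le> m0")
      case True
      have "y m \<le> (\<Sum>m\<le>m0. y m)"
        using True y by (intro member_le_sum) auto
      then have "y m \<le> K * 1"
        using x by (simp add: K_def)
      also have "\<dots> \<le> K * real (L + 1) powr (1 / \<alpha>)"
        using \<open>1 \<le> K\<close> index_pos by (intro mult_left_mono ge_one_powr_ge_zero) auto
      finally show ?thesis
        by (intro order_trans[OF y(2)[of m]] finite_measure_mono) auto
    next
      case False
      have "x * real m powr (1 / \<alpha>) \<le> K * real (L + 1) powr (1 / \<alpha>)"
        using x sum_y index_pos \<open>m \<le> L\<close>
        by (intro mult_mono powr_mono2) (auto simp: K_def)
      then show ?thesis
        using False by (intro order_trans[OF large[of m]] finite_measure_mono) auto
    qed
  qed
qed

text \<open>
  Summing the concentration bound over single times would be too crude: once the walk is near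
  the origin it stays there for a while, and these times are counted over and over. So cut
  time into blocks of length \<open>L\<close> of order \<open>g powr \<alpha>\<close>, in which the walk moves by a distance of order \<open>g\<close>.
  By the maximal inequality, hitting \<open>[-g, g]\<close> during the block that starts at \<open>i * L\<close> costs no more than being within a
  multiple of \<open>g\<close> at its end, which has probability of order \<open>(i + 1) powr - p\<close>. Times after \<open>g\<close> only meet blocks
  with \<open>i \<ge> g div L\<close>, and \<open>g div L\<close> tends to infinity since \<open>\<alpha> < 1\<close>. The tail of a convergent series remains.
\<close>

lemma walk_transient:
  assumes "0 < \<epsilon>"
  shows "\<exists>g0. \<forall>g\<ge>g0. \<forall>N. prob {\<omega> \<in> space M. \<exists>m\<in>{g..N}. \<bar>S m \<omega>\<bar> < int g} \<le> \<epsilon>"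
proof -
  obtain C p r0 where C: "0 < C" "1 < p" "0 < r0"
    and small: "\<forall>r m. r0 \<le> r \<longrightarrow> 0 < m \<longrightarrow>
      prob {\<omega> \<in> space M. \<bar>real_of_int (S m \<omega>)\<bar> \<le> r} \<le> C * (r powr \<alpha> / real m) powr p"
    using prob_walk_small by blast
  obtain K where K: "1 \<le> K" and tight: "\<forall>m L. m \<le> L \<longrightarrow>
      1 / 2 \<le> prob {\<omega> \<in> space M. \<bar>real_of_int (S m \<omega>)\<bar> \<le> K * real (L + 1) powr (1 / \<alpha>)}"
    using walk_tight by blast
  (* 3 bounds (L + 1) / g powr alpha for the block length L below *)
  define D where "D = 1 + K * 3 powr (1 / \<alpha>)"
  define B where "B = 2 * C * (D powr \<alpha>) powr p"
  have D: "1 \<le> D"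
    using K by (simp add: D_def)
  then have B: "0 < B"
    using C by (simp add: B_def)
  have "summable (\<lambda>i. real i powr - p)"
    using C by (simp add: summable_real_powr_iff)
  then have "summable (\<lambda>i. real (Suc i) powr - p)"
    by (rule summable_ignore_initial_segment[of _ 1, simplified])
  from summable_partial_sum_bound[OF this, of "\<epsilon> / B"] B assms obtain i0
    where i0: "\<And>m n. i0 \<le> m \<Longrightarrow> norm (\<Sum>i=m..n. real (Suc i) powr - p) < \<epsilon> / B"
    by auto
  obtain g1 :: nat where g1: "\<And>g. g1 \<le> g \<Longrightarrow> r0 \<le> real g" "\<And>g. g1 \<le> g \<Longrightarrow> 1 \<le> g"
      "\<And>g. g1 \<le> g \<Longrightarrow> real (Suc i0) * (2 * real g powr \<alpha>) \<le> real g"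
  proof -
    have "\<forall>\<^sub>F g in sequentially. real (Suc i0) * (2 * real g powr \<alpha>) \<le> real g"
      using index_pos index_less_1 by real_asymp
    moreover have "\<forall>\<^sub>F g in sequentially. r0 \<le> real g"
      by real_asymp
    ultimately have "\<forall>\<^sub>F g in sequentially. real (Suc i0) * (2 * real g powr \<alpha>) \<le> real g \<and> r0 \<le> real g \<and> 1 \<le> g"
      using eventually_ge_at_top[of 1] by eventually_elim auto
    then show thesis
      using that unfolding eventually_sequentially by blast
  qed
  show ?thesis
  proof (intro exI[of _ g1] allI impI)
    fix g N assume g: "g1 \<le> g"
    have g_ge: "r0 \<le> real g" "1 \<le> real g" "real (Suc i0) * (2 * real g powr \<alpha>) \<le> real g"
      using g1[OF g] by auto
    define L where "L = nat \<lceil>real g powr \<alpha>\<rceil>"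
    have gp: "1 \<le> real g powr \<alpha>"
      using g_ge index_pos by (intro ge_one_powr_ge_zero) auto
    have L: "real g powr \<alpha> \<le> real L" "real L \<le> 2 * real g powr \<alpha>" "0 < L"
    proof -
      show 1: "real g powr \<alpha> \<le> real L"
        unfolding L_def by (rule of_nat_ceiling)
      have "real L = of_int \<lceil>real g powr \<alpha>\<rceil>"
        unfolding L_def using gp by (intro of_nat_nat) linarith
      then show "real L \<le> 2 * real g powr \<alpha>"
        using of_int_ceiling_le_add_one[of "real g powr \<alpha>"] gp by linarith
      show "0 < L"
        using 1 gp by (cases L) auto
    qed
    define R where "R = K * real (L + 1) powr (1 / \<alpha>)"
    have "g + R \<le> D * g"
    proof -
      have "real (L + 1) \<le> 3 * real g powr \<alpha>"
        using L gp by simp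
      then have "real (L + 1) powr (1 / \<alpha>) \<le> (3 * real g powr \<alpha>) powr (1 / \<alpha>)"
        using index_pos by (intro powr_mono2) auto
      also have "\<dots> = 3 powr (1 / \<alpha>) * g"
        using index_pos g_ge by (simp add: powr_mult powr_powr)
      finally have "R \<le> K * (3 powr (1 / \<alpha>) * g)"
        unfolding R_def using K by (intro mult_left_mono) auto
      then show ?thesis
        by (simp add: D_def algebra_simps)
    qed
    have i0_le: "i0 \<le> g div L"
    proof -
      have "real (i0 * L) \<le> real (Suc i0) * (2 * real g powr \<alpha>)"
        using L unfolding of_nat_mult by (intro mult_mono) auto
      then have "real (i0 * L) \<le> real g"
        using g_ge(3) by (rule order_trans)
      then have "i0 * L \<le> g"
        by (simp only: of_nat_le_iff)
      then show ?thesis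
        using L by (simp add: less_eq_div_iff_mult_less_eq)
    qed
    have hit: "prob {\<omega> \<in> space M. \<exists>m\<in>{i*L..i*L+L}. \<bar>real_of_int (S m \<omega>)\<bar> \<le> g} \<le> B * real (Suc i) powr - p" for i
    proof -
      have "prob {\<omega> \<in> space M. \<exists>m\<in>{i*L..i*L+L}. \<bar>real_of_int (S m \<omega>)\<bar> \<le> g} \<le>
          2 * prob {\<omega> \<in> space M. \<bar>real_of_int (S (i * L + L) \<omega>)\<bar> \<le> g + R}"
        unfolding R_def using tight by (intro prob_hit_le) blast
      also have "prob {\<omega> \<in> space M. \<bar>real_of_int (S (i * L + L) \<omega>)\<bar> \<le> g + R} \<le>
          prob {\<omega> \<in> space M. \<bar>real_of_int (S (i * L + L) \<omega>)\<bar> \<le> D * g}"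
        using \<open>g + R \<le> D * g\<close> by (intro finite_measure_mono) auto
      also have "\<dots> \<le> C * ((D * g) powr \<alpha> / real (i * L + L)) powr p"
      proof (rule small[rule_format])
        have "1 * real g \<le> D * g"
          using D by (intro mult_right_mono) auto
        then show "r0 \<le> D * g" using g_ge(1) by linarith
      qed (use L in auto)
      also have "(D * g) powr \<alpha> / real (i * L + L) \<le> D powr \<alpha> / real (Suc i)"
      proof -
        have "(D * g) powr \<alpha> / real (i * L + L) = D powr \<alpha> / real (Suc i) * (real g powr \<alpha> / real L)"
          using D by (simp add: powr_mult algebra_simps)
        also have "\<dots> \<le> D powr \<alpha> / real (Suc i) * 1"
          using L by (intro mult_left_mono) auto
        finally show ?thesis by simp
      qed
      then have "C * ((D * g) powr \<alpha> / real (i * L + L)) powr p \<le> C * (D powr \<alpha> / real (Suc i)) powr p"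
        using C D by (intro mult_left_mono powr_mono2) auto
      also have "2 * (C * (D powr \<alpha> / real (Suc i)) powr p) = B * real (Suc i) powr - p"
        by (simp add: B_def powr_divide powr_minus_divide del: of_nat_Suc)
      finally show ?thesis by simp
    qed
    have "prob {\<omega> \<in> space M. \<exists>m\<in>{g..N}. \<bar>S m \<omega>\<bar> < int g} \<le>
        prob (\<Union>i\<in>{g div L..N}. {\<omega> \<in> space M. \<exists>m\<in>{i*L..i*L+L}. \<bar>real_of_int (S m \<omega>)\<bar> \<le> g})"
    proof (rule finite_measure_mono)
      show "{\<omega> \<in> space M. \<exists>m\<in>{g..N}. \<bar>S m \<omega>\<bar> < int g} \<subseteq>
          (\<Union>i\<in>{g div L..N}. {\<omega> \<in> space M. \<exists>m\<in>{i*L..i*L+L}. \<bar>real_of_int (S m \<omega>)\<bar> \<le> g})"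
      proof
        fix \<omega> assume "\<omega> \<in> {\<omega> \<in> space M. \<exists>m\<in>{g..N}. \<bar>S m \<omega>\<bar> < int g}"
        then obtain m where m: "\<omega> \<in> space M" "g \<le> m" "m \<le> N" "\<bar>S m \<omega>\<bar> < int g" by auto
        have "\<bar>real_of_int (S m \<omega>)\<bar> \<le> g"
          using m(4) by linarith
        moreover have "m div L \<in> {g div L..N}"
          using m div_le_mono[of g m L] order_trans[OF div_le_dividend[of m L] m(3)] by simp
        moreover have "m \<in> {m div L * L..m div L * L + L}"
          unfolding atLeastAtMost_iff
          using div_mult_mod_eq[of m L] mod_less_divisor[OF L(3), of m] by linarith
        ultimately show "\<omega> \<in> (\<Union>i\<in>{g div L..N}. {\<omega> \<in> space M. \<exists>m\<in>{i*L..i*L+L}. \<bar>real_of_int (S m \<omega>)\<bar> \<le> g})"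
          using m(1) by blast
      qed
    qed measurable
    also have "\<dots> \<le> (\<Sum>i=g div L..N. prob {\<omega> \<in> space M. \<exists>m\<in>{i*L..i*L+L}. \<bar>real_of_int (S m \<omega>)\<bar> \<le> g})"
      by (intro measure_UNION_le) auto
    also have "\<dots> \<le> (\<Sum>i=g div L..N. B * real (Suc i) powr - p)"
      by (intro sum_mono hit)
    also have "\<dots> = B * (\<Sum>i=g div L..N. real (Suc i) powr - p)"
      by (simp add: sum_distrib_left)
    also have "\<dots> \<le> B * (\<epsilon> / B)"
      using i0[OF i0_le, of N] B by (intro mult_left_mono) (auto simp: abs_less_iff)
    finally show "prob {\<omega> \<in> space M. \<exists>m\<in>{g..N}. \<bar>S m \<omega>\<bar> < int g} \<le> \<epsilon>"
      using B by simp
  qed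
qed

end

section \<open>Stationary sceneries and mixing\<close>

lemma strictly_stationary_shift:
  assumes "strictly_stationary M \<xi>"
    and P: "Measurable.pred (Pi\<^sub>M UNIV (\<lambda>_. borel)) P"
  shows "measure M {\<omega> \<in> space M. P (\<lambda>k. \<xi> (k + h) \<omega>)} = measure M {\<omega> \<in> space M. P (\<lambda>k. \<xi> k \<omega>)}"
proof -
  let ?B = "Pi\<^sub>M UNIV (\<lambda>_::int. borel :: real measure)"
  have meas [measurable]: "\<xi> k \<in> borel_measurable M" for k
    using assms(1) by (simp add: strictly_stationary_def)
  have S: "{f \<in> space ?B. P f} \<in> sets ?B"
    using P by measurable
  have shifted: "measure M {\<omega> \<in> space M. P (\<lambda>k. \<xi> (k + h) \<omega>)} =
      measure (distr M ?B (\<lambda>\<omega> k. \<xi> (k + h) \<omega>)) {f \<in> space ?B. P f}" for h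
  proof -
    have "(\<lambda>\<omega> k. \<xi> (k + h) \<omega>) \<in> measurable M ?B"
      by (rule measurable_PiM_single') (auto simp: PiE_UNIV_domain)
    from measure_distr[OF this S] show ?thesis
      by (auto intro!: arg_cong[where f = "measure M"] simp: space_PiM)
  qed
  show ?thesis
    using shifted[of h] shifted[of 0] assms(1) by (simp add: strictly_stationary_def)
qed

locale stationary_scenery = prob_space M for M :: "'a measure" +
  fixes \<xi> :: "int \<Rightarrow> 'a \<Rightarrow> real"
  assumes stationary: "strictly_stationary M \<xi>"
begin

abbreviation F :: "int set \<Rightarrow> real \<Rightarrow> real" where
  "F \<equiv> joint_df M \<xi>"

lemma measurable_scenery [measurable]: "\<xi> k \<in> borel_measurable M"
  using stationary by (simp add: strictly_stationary_def)

lemma F_event: "finite A \<Longrightarrow> {\<omega> \<in> space M. \<forall>i\<in>A. \<xi> i \<omega> \<le> v} \<in> events"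
  by measurable

lemma F_empty: "F {} v = 1"
  by (simp add: joint_df_def prob_space)

lemma F_nonneg: "0 \<le> F A v"
  by (simp add: joint_df_def)

lemma F_le_1: "F A v \<le> 1"
  by (simp add: joint_df_def)

lemma F_antimono: "finite A \<Longrightarrow> A \<subseteq> B \<Longrightarrow> finite B \<Longrightarrow> F B v \<le> F A v"
  unfolding joint_df_def by (intro finite_measure_mono F_event) auto

lemma F_shift:
  assumes "finite A"
  shows "F ((\<lambda>k. k + h) ` A) v = F A v"
  unfolding joint_df_def
  using strictly_stationary_shift[OF stationary, of "\<lambda>f. \<forall>i\<in>A. f i \<le> v" h] assms
  by simp

lemma tail_prob_eq: "prob {\<omega> \<in> space M. v < \<xi> k \<omega>} = prob {\<omega> \<in> space M. v < \<xi> 0 \<omega>}"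
  using strictly_stationary_shift[OF stationary, of "\<lambda>f. v < f 0" k] by simp

lemma joint_tail_prob_eq:
  "prob {\<omega> \<in> space M. v < \<xi> i \<omega> \<and> v < \<xi> j \<omega>} = prob {\<omega> \<in> space M. v < \<xi> 0 \<omega> \<and> v < \<xi> (j - i) \<omega>}"
  using strictly_stationary_shift[OF stationary, of "\<lambda>f. v < f 0 \<and> v < f (j - i)" i] by simp

text \<open>
  Discarding a site raises the probability by at most the chance of an exceedance there.
\<close>

lemma F_Un_ge:
  assumes "finite A" "finite B"
  shows "F A v - card B * prob {\<omega> \<in> space M. v < \<xi> 0 \<omega>} \<le> F (A \<union> B) v"
proof -
  have "F A v \<le> prob ({\<omega> \<in> space M. \<forall>i\<in>A \<union> B. \<xi> i \<omega> \<le> v} \<union> (\<Union>i\<in>B. {\<omega> \<in> space M. v < \<xi> i \<omega>}))"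
    unfolding joint_df_def using assms
    by (intro finite_measure_mono) (auto simp: not_le)
  also have "\<dots> \<le> F (A \<union> B) v + prob (\<Union>i\<in>B. {\<omega> \<in> space M. v < \<xi> i \<omega>})"
    unfolding joint_df_def using assms by (intro measure_Un_le) auto
  also have "prob (\<Union>i\<in>B. {\<omega> \<in> space M. v < \<xi> i \<omega>}) \<le> (\<Sum>i\<in>B. prob {\<omega> \<in> space M. v < \<xi> i \<omega>})"
    using assms by (intro measure_UNION_le) auto
  also have "\<dots> = card B * prob {\<omega> \<in> space M. v < \<xi> 0 \<omega>}"
    by (subst sum_constant[symmetric], intro sum.cong tail_prob_eq refl)
  finally show ?thesis by simp
qed

end

text \<open>
  The mixing condition at a single index of the sequence: the level \<open>v\<close>, the gap \<open>l\<close>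
  and the error \<open>a\<close> are numbers.
\<close>

locale mixing_level = stationary_scenery +
  fixes v :: real and l :: nat and a :: real
  assumes gap_pos: "0 < l"
    and mixing: "\<And>I J. finite I \<Longrightarrow> I \<noteq> {} \<Longrightarrow> finite J \<Longrightarrow> J \<noteq> {} \<Longrightarrow> Max I + int l \<le> Min J
      \<Longrightarrow> \<bar>F (I \<union> J) v - F I v * F J v\<bar> \<le> a"
begin

definition tail_prob :: real where
  "tail_prob = prob {\<omega> \<in> space M. v < \<xi> 0 \<omega>}"

lemma error_nonneg: "0 \<le> a"
  using mixing[of "{0}" "{int l}"] by (simp add: order_trans[OF abs_ge_zero])

lemma mixing':
  assumes "finite I" "finite J" "\<And>i j. i \<in> I \<Longrightarrow> j \<in> J \<Longrightarrow> i + int l \<le> j"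
  shows "\<bar>F (I \<union> J) v - F I v * F J v\<bar> \<le> a"
proof (cases "I = {} \<or> J = {}")
  case True
  then show ?thesis using error_nonneg by (auto simp: F_empty)
next
  case False
  then show ?thesis using assms by (intro mixing) auto
qed

text \<open>
  Suppose that \<open>A\<close> contains the largest point of the union, and let \<open>A1\<close> be its part to the right of
  \<open>B\<close>. It can be split off from \<open>A \<union> B\<close>, and also from \<open>A\<close>, since a point of \<open>B\<close> separates it from the
  rest of \<open>A\<close>. This costs two errors, and the induction continues with \<open>A - A1\<close> and \<open>B\<close>. The other case
  is symmetric.
\<close>

lemma mixing_separated:
  assumes "finite A" "finite B" "\<And>x y. x \<in> A \<Longrightarrow> y \<in> B \<Longrightarrow> int l \<le> \<bar>x - y\<bar>"
  shows "\<bar>F (A \<union> B) v - F A v * F B v\<bar> \<le> 2 * real (card A + card B) * a"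
  using assms
proof (induction "card A + card B" arbitrary: A B rule: less_induct)
  case less
  show ?case
  proof (cases "A = {} \<or> B = {}")
    case True
    then show ?thesis using error_nonneg by (auto simp: F_empty)
  next
    case False
    have step: "\<bar>F (A \<union> B) v - F A v * F B v\<bar> \<le> 2 * real (card A + card B) * a"
      if fin: "finite A" "finite B" and ne: "A \<noteq> {}" "B \<noteq> {}"
        and sep: "\<And>x y. x \<in> A \<Longrightarrow> y \<in> B \<Longrightarrow> int l \<le> \<bar>x - y\<bar>"
        and IH: "\<And>A'. finite A' \<Longrightarrow> card A' + card B < card A + card B \<Longrightarrow> A' \<subseteq> A \<Longrightarrow>
          \<bar>F (A' \<union> B) v - F A' v * F B v\<bar> \<le> 2 * real (card A' + card B) * a"
        and max: "Max B < Max A" for A B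
    proof -
      define A0 where "A0 = {x \<in> A. x \<le> Max B}"
      define A1 where "A1 = {x \<in> A. Max B < x}"
      have A: "A = A0 \<union> A1" and fin': "finite A0" "finite A1" and disj: "A0 \<inter> A1 = {}"
        using fin by (auto simp: A0_def A1_def)
      have mem: "Max A \<in> A" "Max B \<in> B"
        using fin ne by auto
      have "Max A \<in> A1"
        using mem max by (simp add: A1_def)
      then have card: "card A0 < card A"
        using A disj fin by (intro psubset_card_mono) auto
      have far: "x + int l \<le> y" if "x \<in> B \<union> A0" "y \<in> A1" for x y
      proof -
        have "x \<le> Max B"
          using that fin by (auto simp: A0_def)
        moreover have "Max B + int l \<le> y"
          using that sep[of y "Max B"] mem by (auto simp: A1_def)
        ultimately show ?thesis by simp
      qed
      have 1: "\<bar>F ((A0 \<union> B) \<union> A1) v - F (A0 \<union> B) v * F A1 v\<bar> \<le> a"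
        using far fin fin' by (intro mixing') auto
      have 2: "\<bar>F (A0 \<union> A1) v - F A0 v * F A1 v\<bar> \<le> a"
        using far fin' by (intro mixing') auto
      have 3: "\<bar>F (A0 \<union> B) v - F A0 v * F B v\<bar> \<le> 2 * real (card A0 + card B) * a"
        using card by (intro IH) (auto simp: fin' A)
      have "F (A \<union> B) v - F A v * F B v =
          (F ((A0 \<union> B) \<union> A1) v - F (A0 \<union> B) v * F A1 v)
          + F A1 v * (F (A0 \<union> B) v - F A0 v * F B v) - F B v * (F (A0 \<union> A1) v - F A0 v * F A1 v)"
        by (simp add: A algebra_simps Un_ac)
      also have "\<bar>\<dots>\<bar> \<le> a + 1 * (2 * real (card A0 + card B) * a) + 1 * a"
      proof -
        have tri: "\<bar>x + y * z - w * t\<bar> \<le> a + 1 * d + 1 * a"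
          if "\<bar>x\<bar> \<le> a" "\<bar>z\<bar> \<le> d" "\<bar>t\<bar> \<le> a" "0 \<le> y" "y \<le> 1" "0 \<le> w" "w \<le> 1" for x y z w t d :: real
        proof -
          have "\<bar>y * z\<bar> \<le> 1 * d" "\<bar>w * t\<bar> \<le> 1 * a"
            unfolding abs_mult using that by - (intro mult_mono; simp)+
          then show ?thesis using that(1) by linarith
        qed
        show ?thesis
          by (rule tri[OF 1 3 2 F_nonneg F_le_1 F_nonneg F_le_1])
      qed
      also have "\<dots> = 2 * real (Suc (card A0) + card B) * a"
        by (simp add: algebra_simps)
      also have "\<dots> \<le> 2 * real (card A + card B) * a"
        using card error_nonneg by (intro mult_right_mono) auto
      finally show ?thesis .
    qed
    have "Max A \<in> A" "Max B \<in> B"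
      using False less.prems by auto
    then have "Max A \<noteq> Max B"
      using less.prems(3)[of "Max A" "Max B"] gap_pos by auto
    then consider "Max B < Max A" | "Max A < Max B" by linarith
    then show ?thesis
    proof cases
      case 1
      show ?thesis
      proof (rule step)
        fix A' assume A': "finite A'" "card A' + card B < card A + card B" "A' \<subseteq> A"
        then show "\<bar>F (A' \<union> B) v - F A' v * F B v\<bar> \<le> 2 * real (card A' + card B) * a"
          using less.prems by (intro less.hyps) blast+
      qed (use False less.prems 1 in \<open>fast+\<close>)
    next
      case 2
      have "\<bar>F (B \<union> A) v - F B v * F A v\<bar> \<le> 2 * real (card B + card A) * a"
      proof (rule step)
        fix B' assume B': "finite B'" "card B' + card A < card B + card A" "B' \<subseteq> B"
        have "\<bar>F (A \<union> B') v - F A v * F B' v\<bar> \<le> 2 * real (card A + card B') * a"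
        proof (rule less.hyps)
          show "card A + card B' < card A + card B"
            using B'(2) by linarith
        qed (use B' less.prems in blast)+
        then show "\<bar>F (B' \<union> A) v - F B' v * F A v\<bar> \<le> 2 * real (card B' + card A) * a"
          by (simp add: Un_commute mult.commute add.commute)
      next
        fix x y assume "x \<in> B" "y \<in> A"
        then show "int l \<le> \<bar>x - y\<bar>"
          using less.prems(3)[of y x] by (simp add: abs_minus_commute)
      qed (use False less.prems 2 in \<open>fast+\<close>)
      then show ?thesis
        by (simp add: Un_commute mult.commute add.commute)
    qed
  qed
qed

text \<open>
  Close points are discarded from \<open>B\<close> only; this already separates the two sets.
\<close>

lemma mixing_up_to_close_points:
  assumes "finite A" "finite B"
  shows "\<bar>F (A \<union> B) v - F A v * F B v\<bar> \<le>
    card {y \<in> B. \<exists>x\<in>A. \<bar>x - y\<bar> < int l} * tail_prob + 2 * real (card A + card B) * a"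
proof -
  define C where "C = {y \<in> B. \<exists>x\<in>A. \<bar>x - y\<bar> < int l}"
  define B' where "B' = B - C"
  have fin: "finite C" "finite B'" and B: "B = B' \<union> C"
    using assms by (auto simp: C_def B'_def)
  have 1: "\<bar>F (A \<union> B') v - F A v * F B' v\<bar> \<le> 2 * real (card A + card B') * a"
    using assms fin by (intro mixing_separated) (auto simp: B'_def C_def not_less)
  also have "\<dots> \<le> 2 * real (card A + card B) * a"
    using error_nonneg assms by (intro mult_right_mono) (auto simp: B'_def intro!: card_mono)
  finally have 1: "\<bar>F (A \<union> B') v - F A v * F B' v\<bar> \<le> 2 * real (card A + card B) * a" .
  have 2: "F (A \<union> B') v - card C * tail_prob \<le> F (A \<union> B) v" "F (A \<union> B) v \<le> F (A \<union> B') v"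
    using F_Un_ge[of "A \<union> B'" C v] F_antimono[of "A \<union> B'" "A \<union> B" v] assms fin
    by (auto simp: B Un_ac tail_prob_def)
  have 3: "F B' v - card C * tail_prob \<le> F B v" "F B v \<le> F B' v"
    using F_Un_ge[of B' C v] F_antimono[of B' B v] assms fin
    by (auto simp: B tail_prob_def)
  have "F A v * (F B' v - F B v) \<le> 1 * (card C * tail_prob)"
    using 3 F_nonneg F_le_1 by (intro mult_mono) auto
  moreover have "0 \<le> F A v * (F B' v - F B v)"
    using 3 F_nonneg by auto
  ultimately have 4: "F A v * F B' v - F A v * F B v \<le> card C * tail_prob" "F A v * F B v \<le> F A v * F B' v"
    unfolding right_diff_distrib by linarith+
  have "\<bar>y - z\<bar> \<le> k + e"
    if "\<bar>x - w\<bar> \<le> e" "x - k \<le> y" "y \<le> x" "w - z \<le> k" "z \<le> w" for x y z w k e :: real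
    using that by linarith
  from this[OF 1 2 4] show ?thesis
    by (simp only: C_def)
qed

lemma joint_tail_le:
  assumes "i + int l \<le> j"
  shows "prob {\<omega> \<in> space M. v < \<xi> i \<omega> \<and> v < \<xi> j \<omega>} \<le> tail_prob\<^sup>2 + a"
proof -
  define E where "E k = {\<omega> \<in> space M. v < \<xi> k \<omega>}" for k
  have E: "E k \<in> events" for k
    unfolding E_def by measurable
  have pE: "prob (E k) = tail_prob" for k
    unfolding E_def tail_prob_def by (rule tail_prob_eq)
  have F_compl: "F A v = 1 - prob (\<Union>k\<in>A. E k)" if "finite A" for A
  proof -
    have "{\<omega> \<in> space M. \<forall>i\<in>A. \<xi> i \<omega> \<le> v} = space M - (\<Union>k\<in>A. E k)"
      by (auto simp: E_def not_less)
    then show ?thesis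
      unfolding joint_df_def using E that by (simp add: prob_compl sets.finite_UN)
  qed
  have "prob (E i \<union> E j) = prob (E i) + prob (E j - E i)"
    using E finite_measure_Union'[of "E i" "E j"] by simp
  moreover have "prob (E j - E i) = prob (E j) - prob (E j \<inter> E i)"
    using E by (intro finite_measure_Diff') auto
  moreover have "E j \<inter> E i = {\<omega> \<in> space M. v < \<xi> i \<omega> \<and> v < \<xi> j \<omega>}"
    by (auto simp: E_def)
  moreover have "F ({i} \<union> {j}) v - F {i} v * F {j} v \<le> a"
    using assms by (intro abs_le_D1[OF mixing']) auto
  ultimately show ?thesis
    by (simp add: F_compl pE power2_eq_square algebra_simps Un_commute)
qed

text \<open>
  Up to the factor \<open>n\<close> this is the sum in the anti-clustering condition.
\<close>

definition clustering :: "nat \<Rightarrow> real" where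
  "clustering s = (\<Sum>j=1..s. prob {\<omega> \<in> space M. v < \<xi> 0 \<omega> \<and> v < \<xi> (int j) \<omega>})"

text \<open>
  A Bonferroni inequality, proved by adding points in increasing order. When \<open>x\<close> is added, pairs
  with an earlier point at distance at most \<open>s\<close> contribute the clustering sum, whatever the geometry of \<open>A\<close>,
  and the at most \<open>s\<close> remaining pairs are controlled by the mixing condition.
\<close>

lemma F_le_Bonferroni:
  assumes "finite A" "card A \<le> s" "l \<le> s"
  shows "F A v \<le> 1 - card A * (tail_prob - clustering s - s * (tail_prob\<^sup>2 + a))"
  using assms
proof (induction A rule: finite_linorder_max_induct)
  case empty
  then show ?case by (simp add: F_empty)
next
  case (insert x A)
  let ?q = "\<lambda>i j. prob {\<omega> \<in> space M. v < \<xi> i \<omega> \<and> v < \<xi> j \<omega>}"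
  have fin: "finite A" and x: "x \<notin> A"
    using insert.hyps by blast+
  have card: "card A < s"
    using insert.prems fin x by simp
  have IH: "F A v \<le> 1 - card A * (tail_prob - clustering s - s * (tail_prob\<^sup>2 + a))"
    using card insert.prems(2) by (intro insert.IH) simp_all
  define N where "N = {i \<in> A. x - i \<le> int s}"
  have near: "(\<Sum>i\<in>N. ?q i x) \<le> clustering s"
  proof -
    have "(\<Sum>i\<in>N. ?q i x) = (\<Sum>i\<in>N. ?q 0 (int (nat (x - i))))"
    proof (rule sum.cong)
      fix i assume "i \<in> N"
      then have "int (nat (x - i)) = x - i"
        using insert.hyps by (auto simp: N_def less_imp_le)
      then show "?q i x = ?q 0 (int (nat (x - i)))"
        using joint_tail_prob_eq[of v i x] by simp
    qed simp
    also have "\<dots> = (\<Sum>j\<in>(\<lambda>i. nat (x - i)) ` N. ?q 0 (int j))"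
      using insert.hyps by (subst sum.reindex) (auto simp: N_def inj_on_def)
    also have "\<dots> \<le> clustering s"
      unfolding clustering_def using insert.hyps fin
      by (intro sum_mono2) (auto simp: N_def Suc_le_eq nat_le_iff)
    finally show ?thesis .
  qed
  have far: "(\<Sum>i\<in>A - N. ?q i x) \<le> s * (tail_prob\<^sup>2 + a)"
  proof -
    have "(\<Sum>i\<in>A - N. ?q i x) \<le> card (A - N) * (tail_prob\<^sup>2 + a)"
      using insert.prems by (intro sum_bounded_above joint_tail_le) (auto simp: N_def)
    also have "\<dots> \<le> s * (tail_prob\<^sup>2 + a)"
      using card card_mono[OF fin, of "A - N"] error_nonneg
      by (intro mult_right_mono) simp_all
    finally show ?thesis .
  qed
  have split: "(\<Sum>i\<in>A. ?q i x) = (\<Sum>i\<in>N. ?q i x) + (\<Sum>i\<in>A - N. ?q i x)"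
    using fin by (subst sum.subset_diff[of N A]) (auto simp: N_def)
  have "tail_prob \<le> prob (({\<omega> \<in> space M. \<forall>i\<in>A. \<xi> i \<omega> \<le> v} - {\<omega> \<in> space M. \<forall>i\<in>insert x A. \<xi> i \<omega> \<le> v})
      \<union> (\<Union>i\<in>A. {\<omega> \<in> space M. v < \<xi> i \<omega> \<and> v < \<xi> x \<omega>}))"
    unfolding tail_prob_def tail_prob_eq[of v x, symmetric] using fin
    by (intro finite_measure_mono) (auto simp: not_le)
  also have "\<dots> \<le> prob ({\<omega> \<in> space M. \<forall>i\<in>A. \<xi> i \<omega> \<le> v} - {\<omega> \<in> space M. \<forall>i\<in>insert x A. \<xi> i \<omega> \<le> v})
      + prob (\<Union>i\<in>A. {\<omega> \<in> space M. v < \<xi> i \<omega> \<and> v < \<xi> x \<omega>})"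
    using fin by (intro measure_Un_le) auto
  also have "prob ({\<omega> \<in> space M. \<forall>i\<in>A. \<xi> i \<omega> \<le> v} - {\<omega> \<in> space M. \<forall>i\<in>insert x A. \<xi> i \<omega> \<le> v})
      = F A v - F (insert x A) v"
    unfolding joint_df_def using fin by (intro finite_measure_Diff) auto
  also have "prob (\<Union>i\<in>A. {\<omega> \<in> space M. v < \<xi> i \<omega> \<and> v < \<xi> x \<omega>}) \<le> (\<Sum>i\<in>A. ?q i x)"
    using fin by (intro measure_UNION_le) auto
  finally have "F (insert x A) v \<le> F A v - (tail_prob - clustering s - s * (tail_prob\<^sup>2 + a))"
    using near far split by simp
  then show ?case
    using IH fin x by (simp add: algebra_simps)
qed

text \<open>
  Cut off the \<open>s\<close> smallest points, discard the next \<open>l\<close> points to create a gap, and iterate.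
\<close>

lemma F_le_blocks:
  assumes block: "\<And>A. finite A \<Longrightarrow> card A = s \<Longrightarrow> F A v \<le> b" and b: "0 \<le> b" "b \<le> 1"
    and "finite A" "q * (s + l) \<le> card A"
  shows "F A v \<le> b ^ q + q * a"
  using assms(4,5)
proof (induction q arbitrary: A)
  case 0
  then show ?case by (simp add: F_le_1)
next
  case (Suc q)
  define xs where "xs = sorted_list_of_set A"
  have xs: "sorted xs" "distinct xs" "set xs = A" "length xs = card A"
    using Suc.prems by (simp_all add: xs_def)
  define B where "B = set (take s xs)"
  define C where "C = set (drop (s + l) xs)"
  have sub: "B \<subseteq> A" "C \<subseteq> A"
    using xs set_take_subset[of s xs] set_drop_subset[of "s + l" xs] by (auto simp: B_def C_def)
  have fin: "finite B" "finite C" by (auto simp: B_def C_def)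
  have cB: "card B = s" 
    using xs Suc.prems by (simp add: B_def distinct_card)
  have cC: "card C = card A - (s + l)"
    using xs by (simp add: C_def distinct_card)
  have far: "x + int l \<le> y" if "x \<in> B" "y \<in> C" for x y
  proof -
    from that obtain i where i: "i < s" "i < length xs" "x = xs ! i"
      by (auto simp: B_def in_set_conv_nth)
    from that obtain j where j: "j < length (drop (s + l) xs)" "y = drop (s + l) xs ! j"
      unfolding C_def in_set_conv_nth by blast
    then have j: "s + l + j < length xs" "y = xs ! (s + l + j)"
      by simp_all
    have "xs ! i + int d \<le> xs ! (i + d)" if "i + d < length xs" for d
      using that
    proof (induction d)
      case (Suc d)
      have "xs ! (i + d) < xs ! (i + Suc d)"
        using xs Suc.prems
        by (metis add_Suc_right lessI order.strict_trans sorted_wrt_nth_less strict_sorted_iff)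
      with Suc show ?case by simp
    qed simp
    from this[of "s + l + j - i"] i j show ?thesis by (simp add: of_nat_diff)
  qed
  have "F A v \<le> F (B \<union> C) v"
    using Suc.prems sub fin by (intro F_antimono) auto
  also have "\<dots> \<le> F B v * F C v + a"
    using mixing'[OF fin far] by (simp add: abs_if split: if_splits)
  also have "\<dots> \<le> b * (b ^ q + q * a) + a"
    using cC Suc.prems fin cB b by (intro add_mono mult_mono block Suc.IH) (auto simp: F_nonneg)
  also have "b * (b ^ q + q * a) \<le> b ^ Suc q + 1 * (q * a)"
    using b error_nonneg mult_right_mono[of b 1 "q * a"] by (simp add: algebra_simps)
  finally show ?case by (simp add: algebra_simps)
qed

lemma F_le_exp:
  assumes "finite A" "q * (s + l) \<le> card A" "l \<le> s" "c \<le> tail_prob - clustering s - s * (tail_prob\<^sup>2 + a)"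
  shows "F A v \<le> exp (- (q * s * c)) + q * a"
proof -
  have "F B v \<le> min 1 (exp (- (s * c)))" if "finite B" "card B = s" for B
  proof -
    have "F B v \<le> 1 - s * (tail_prob - clustering s - s * (tail_prob\<^sup>2 + a))"
      using F_le_Bonferroni[of B s] that assms by simp
    also have "\<dots> \<le> 1 - s * c"
      using assms by (intro diff_left_mono mult_left_mono) auto
    also have "\<dots> \<le> exp (- (s * c))"
      using exp_ge_add_one_self[of "- (s * c)"] by simp
    finally show ?thesis by (simp add: F_le_1)
  qed
  then have "F A v \<le> min 1 (exp (- (s * c))) ^ q + q * a"
    using assms by (intro F_le_blocks[where s = s]) auto
  also have "min 1 (exp (- (s * c))) ^ q \<le> exp (- (s * c)) ^ q"
    by (intro power_mono) auto
  also have "exp (- (s * c)) ^ q = exp (- (q * s * c))"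
    by (simp flip: exp_of_nat_mult add: mult_ac)
  finally show ?thesis by simp
qed

end

context stationary_scenery
begin

lemma mixing_level_of_D:
  assumes "D_cond_with M \<xi> u a l"
  shows "mixing_level M \<xi> (u n) (l n) (a n (l n))"
proof unfold_locales
  have l: "0 < l n" for n
    using assms by (simp add: D_cond_with_def)
  show "0 < l n" by (rule l)
  fix I J :: "int set"
  assume "finite I" "I \<noteq> {}" "finite J" "J \<noteq> {}" and gap: "Max I + int (l n) \<le> Min J"
  moreover have "Max I < Min J"
    using gap l[of n] by linarith
  ultimately show "\<bar>F (I \<union> J) (u n) - F I (u n) * F J (u n)\<bar> \<le> a n (l n)"
    using assms unfolding D_cond_with_def by blast
qed

lemma number_of_blocks_le:
  assumes D: "D_cond_with M \<xi> u a l" and k: "(\<lambda>n. real (k n * l n)) \<in> o(\<lambda>n. real n)"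
  shows "\<forall>\<^sub>F n in sequentially. k n * l n \<le> n \<and> k n \<le> n"
proof -
  have "\<forall>\<^sub>F n in sequentially. norm (real (k n * l n)) \<le> 1 * norm (real n)"
    using landau_o.smallD[OF k zero_less_one] .
  then show ?thesis
  proof eventually_elim
    case (elim n)
    then have "real (k n * l n) \<le> real n" by simp
    then have "k n * l n \<le> n" by (simp only: of_nat_le_iff)
    moreover have "k n * 1 \<le> k n * l n"
      using D by (intro mult_left_mono) (auto simp: D_cond_with_def Suc_le_eq)
    ultimately show ?case by linarith
  qed
qed

text \<open>
  The anti-clustering condition provides \<open>n^2 / k n * a n (l n) \<longlonglongrightarrow> 0\<close>, and \<open>k n \<le> n\<close>
  because \<open>k n * l n = o(n)\<close>.
\<close>

lemma scaled_error_tendsto_0: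
  assumes D: "D_cond_with M \<xi> u a l" and D': "D'_cond_with M \<xi> u a l"
  shows "(\<lambda>n. real n * a n (l n)) \<longlonglongrightarrow> 0"
proof -
  from D' obtain k where k: "filterlim k at_top sequentially"
    "(\<lambda>n. (real n)\<^sup>2 / real (k n) * a n (l n)) \<longlonglongrightarrow> 0"
    "(\<lambda>n. real (k n * l n)) \<in> o(\<lambda>n. real n)"
    unfolding D'_cond_with_def by blast
  interpret level: mixing_level M \<xi> "u n" "l n" "a n (l n)" for n
    by (rule mixing_level_of_D[OF D])
  have "\<forall>\<^sub>F n in sequentially. 1 \<le> k n"
    using k(1) by (simp add: filterlim_at_top)
  with number_of_blocks_le[OF D k(3)]
  have upper: "\<forall>\<^sub>F n in sequentially. real n * a n (l n) \<le> (real n)\<^sup>2 / real (k n) * a n (l n)"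
  proof eventually_elim
    case (elim n)
    then have "real n * real (k n) \<le> (real n)\<^sup>2"
      unfolding power2_eq_square by (intro mult_left_mono) auto
    then have "real n \<le> (real n)\<^sup>2 / real (k n)"
      using elim by (simp add: pos_le_divide_eq)
    then show ?case
      by (intro mult_right_mono level.error_nonneg)
  qed
  show ?thesis
    by (rule tendsto_sandwich[OF _ upper tendsto_const k(2)]) (intro always_eventually allI mult_nonneg_nonneg level.error_nonneg of_nat_0_le_iff)
qed

text \<open>
  Blocks of \<open>s = n div k n\<close> points, the range of the clustering sum, have an exceedance with
  probability at least about \<open>s * \<tau> / n\<close>: the conditions on \<open>k n\<close> say exactly that both corrections in the
  Bonferroni inequality are negligible compared with \<open>\<tau> / n\<close>. A set of \<open>K * n\<close> points contains at least
  \<open>K * n / (4 * s)\<close> such blocks together with the gaps between them, so the probability of no exceedance is at most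
  about \<open>exp (- K * \<tau> / 8)\<close>.
\<close>

lemma F_large_sets_small:
  assumes tau: "0 < \<tau>" and tail: "(\<lambda>n. real n * prob {\<omega> \<in> space M. \<xi> 0 \<omega> > u n}) \<longlonglongrightarrow> \<tau>"
    and D: "D_cond_with M \<xi> u a l" and D': "D'_cond_with M \<xi> u a l" and eps: "0 < \<epsilon>"
  shows "\<exists>K>0. \<forall>\<^sub>F n in sequentially. \<forall>A. finite A \<longrightarrow> K * n \<le> card A \<longrightarrow> F A (u n) \<le> \<epsilon>"
proof -
  from D' obtain k where k: "filterlim k at_top sequentially"
    "(\<lambda>n. (real n)\<^sup>2 / real (k n) * a n (l n)) \<longlonglongrightarrow> 0"
    "(\<lambda>n. real (k n * l n)) \<in> o(\<lambda>n. real n)"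
    and sum: "(\<lambda>n. real n * (\<Sum>j=1..n div k n. prob {\<omega> \<in> space M. \<xi> 0 \<omega> > u n \<and> \<xi> (of_nat j) \<omega> > u n})) \<longlonglongrightarrow> 0"
    unfolding D'_cond_with_def by blast
  interpret level: mixing_level M \<xi> "u n" "l n" "a n (l n)" for n
    by (rule mixing_level_of_D[OF D])
  define p where "p n = prob {\<omega> \<in> space M. u n < \<xi> 0 \<omega>}" for n
  define c where "c n = (\<Sum>j=1..n div k n. prob {\<omega> \<in> space M. u n < \<xi> 0 \<omega> \<and> u n < \<xi> (int j) \<omega>})" for n
  define A where "A n = a n (l n)" for n
  have A: "0 \<le> A n" for n
    unfolding A_def by (rule level.error_nonneg)
  have np: "(\<lambda>n. real n * p n) \<longlonglongrightarrow> \<tau>"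
    using tail by (simp add: p_def)
  have nc: "(\<lambda>n. real n * c n) \<longlonglongrightarrow> 0"
    using sum by (simp add: c_def)
  have nA: "(\<lambda>n. (real n)\<^sup>2 / real (k n) * A n) \<longlonglongrightarrow> 0"
    using k(2) by (simp add: A_def)
  have "filterlim (\<lambda>n. real (k n)) at_top sequentially"
    by (rule filterlim_compose[OF filterlim_real_sequentially k(1)])
  then have inv: "(\<lambda>n. inverse (real (k n))) \<longlonglongrightarrow> 0"
    by (rule tendsto_inverse_0_at_top)
  have "(\<lambda>n. real n * p n - real n * c n - (real n * p n)\<^sup>2 * inverse (real (k n)) - (real n)\<^sup>2 / real (k n) * A n)
      \<longlonglongrightarrow> \<tau> - 0 - \<tau>\<^sup>2 * 0 - 0"
    by (intro tendsto_intros np nc nA inv)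
  then have rate: "\<forall>\<^sub>F n in sequentially. \<tau> / 2 <
      real n * p n - real n * c n - (real n * p n)\<^sup>2 * inverse (real (k n)) - (real n)\<^sup>2 / real (k n) * A n"
    by (rule order_tendstoD) (use tau in simp)
  obtain K :: nat where K0: "max 1 (8 / \<tau> * ln (2 / \<epsilon>)) < real K"
    using reals_Archimedean2 by blast
  then have K: "1 \<le> K" "ln (2 / \<epsilon>) \<le> real K * \<tau> / 8"
    using tau by (auto simp: field_simps)
  have "exp (- (real K * \<tau> / 8)) \<le> exp (- ln (2 / \<epsilon>))"
    using K by simp
  also have "\<dots> = \<epsilon> / 2"
    using eps by (simp add: exp_minus)
  finally have exp_K: "exp (- (real K * \<tau> / 8)) \<le> \<epsilon> / 2" .
  have "(\<lambda>n. real K * (real n * A n)) \<longlonglongrightarrow> real K * 0"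
    unfolding A_def by (intro tendsto_intros scaled_error_tendsto_0[OF D D'])
  then have "\<forall>\<^sub>F n in sequentially. real K * (real n * A n) < \<epsilon> / 2"
    by (rule order_tendstoD) (use eps in simp)
  moreover have "\<forall>\<^sub>F n in sequentially. 4 \<le> k n"
    using k(1) by (simp add: filterlim_at_top)
  ultimately have "\<forall>\<^sub>F n in sequentially. \<forall>B. finite B \<longrightarrow> K * n \<le> card B \<longrightarrow> F B (u n) \<le> \<epsilon>"
    using rate number_of_blocks_le[OF D k(3)] eventually_gt_at_top[of 0]
  proof eventually_elim
    case (elim n)
    note err = elim(1) and k4 = elim(2) and rate = elim(3) and kl = elim(4) and n = elim(5)
    define s where "s = n div k n"
    define q where "q = (K * n) div (2 * s)"
    have ls: "l n \<le> s"
      using kl k4 unfolding s_def by (simp add: less_eq_div_iff_mult_less_eq mult.commute)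
    have "0 < l n"
      by (rule level.gap_pos)
    then have s: "0 < s" using ls by simp
    have sk: "s * k n \<le> n"
      unfolding s_def by simp
    then have "real s * real (k n) \<le> real n"
      by (simp flip: of_nat_mult)
    then have s_le: "real s \<le> real n / real (k n)"
      using k4 by (simp add: pos_le_divide_eq)
    have "s * 4 \<le> s * k n"
      using k4 by simp
    then have s4: "4 * s \<le> n"
      using sk by linarith
    have rate_s: "\<tau> / (2 * n) \<le> p n - c n - s * ((p n)\<^sup>2 + A n)"
    proof -
      have "real n * (s * ((p n)\<^sup>2 + A n)) \<le> real n * (real n / real (k n) * ((p n)\<^sup>2 + A n))"
        using s_le A by (intro mult_left_mono mult_right_mono) auto
      also have "\<dots> = (real n * p n)\<^sup>2 * inverse (real (k n)) + (real n)\<^sup>2 / real (k n) * A n"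
        by (simp add: power2_eq_square divide_inverse algebra_simps)
      finally have "\<tau> / 2 \<le> real n * (p n - c n - s * ((p n)\<^sup>2 + A n))"
        using rate by (simp add: algebra_simps)
      then show ?thesis
        using n by (simp add: field_simps)
    qed
    have "K * n < (q + 1) * (2 * s)"
      unfolding q_def using s dividend_less_times_div[of "2 * s" "K * n"] by (simp add: mult.commute)
    moreover have "4 * s \<le> K * n"
      using s4 K(1) by (metis le_trans mult_le_mono1 nat_mult_1)
    ultimately have "K * n \<le> 4 * (q * s)"
      by (simp add: algebra_simps)
    then have "real (K * n) \<le> real (4 * (q * s))"
      by (simp only: of_nat_le_iff)
    then have qs: "real K * n / 4 \<le> real q * s"
      by simp
    show ?case
    proof (intro allI impI)
      fix B :: "int set" assume B: "finite B" "K * n \<le> card B"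
      have "q * (s + l n) \<le> q * (2 * s)"
        using ls by (intro mult_left_mono) auto
      also have "\<dots> \<le> K * n"
        unfolding q_def by simp
      finally have q_le: "q * (s + l n) \<le> card B"
        using B by simp
      have "F B (u n) \<le> exp (- (real q * real s * (\<tau> / (2 * n)))) + real q * A n"
        unfolding A_def using B q_le ls rate_s
        by (intro level.F_le_exp) (auto simp: level.tail_prob_def level.clustering_def p_def c_def s_def A_def)
      also have "exp (- (real q * real s * (\<tau> / (2 * n)))) \<le> exp (- (real K * \<tau> / 8))"
      proof -
        have "real K * n / 4 * (\<tau> / (2 * n)) \<le> real q * s * (\<tau> / (2 * n))"
          using qs tau by (intro mult_right_mono) auto
        then show ?thesis
          using n by (simp add: field_simps)
      qed
      also have "real q * A n \<le> real K * (real n * A n)"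
      proof -
        have "q \<le> K * n"
          unfolding q_def by (rule div_le_dividend)
        then have "real q \<le> real K * real n"
          by (simp flip: of_nat_mult)
        then show ?thesis
          using A[of n] by (simp add: mult_right_mono flip: mult.assoc)
      qed
      finally show "F B (u n) \<le> \<epsilon>"
        using exp_K err by simp
    qed
  qed
  then show ?thesis
    using K by (intro exI[of _ K]) auto
qed

end

section \<open>A walk in a random scenery\<close>

locale walk_in_scenery = iid_walk M X + stationary_scenery M \<xi>
  for M :: "'a measure" and X :: "nat \<Rightarrow> 'a \<Rightarrow> int" and \<xi> :: "int \<Rightarrow> 'a \<Rightarrow> real" +
  assumes scenery_indep: "indep_processes M (\<lambda>_. borel) \<xi> (\<lambda>_. count_space UNIV) (walk X)"
begin

abbreviation G :: "nat set \<Rightarrow> real \<Rightarrow> real" where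
  "G \<equiv> joint_df M (\<lambda>n \<omega>. \<xi> (S n \<omega>) \<omega>)"

abbreviation sites :: "nat set \<Rightarrow> 'a \<Rightarrow> int set" where
  "sites I \<omega> \<equiv> (\<lambda>i. S i \<omega>) ` I"

lemma sites_event: "finite I \<Longrightarrow> finite A \<Longrightarrow> {\<omega> \<in> space M. sites I \<omega> = A} \<in> events"
proof -
  assume [simp]: "finite I" "finite A"
  have "{\<omega> \<in> space M. sites I \<omega> = A} = {\<omega> \<in> space M. (\<forall>i\<in>I. S i \<omega> \<in> A) \<and> (\<forall>x\<in>A. \<exists>i\<in>I. S i \<omega> = x)}"
    by auto
  also have "\<dots> \<in> events" by measurable
  finally show ?thesis .
qed

text \<open>
  Independence of the two processes is used only here, for a single set of sites at a time;
  expectations of arbitrary functions of both processes are recovered by countable summation.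
\<close>

lemma prob_sites_and_scenery:
  assumes fin: "finite I" "finite A"
  shows "prob {\<omega> \<in> space M. sites I \<omega> = A \<and> (\<forall>k\<in>A. \<xi> k \<omega> \<le> v)} =
    prob {\<omega> \<in> space M. sites I \<omega> = A} * F A v"
proof -
  let ?B = "Pi\<^sub>M UNIV (\<lambda>_::int. borel :: real measure)"
  let ?W = "Pi\<^sub>M UNIV (\<lambda>_::nat. count_space (UNIV :: int set))"
  let ?E = "{f \<in> space ?B. \<forall>k\<in>A. f k \<le> v}"
  let ?H = "{f \<in> space ?W. (\<forall>i\<in>I. f i \<in> A) \<and> (\<forall>x\<in>A. \<exists>i\<in>I. f i = x)}"
  have E: "?E \<in> sets ?B"
    using fin by measurable
  have H: "?H \<in> sets ?W"
    using fin by measurable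
  have "prob (((\<lambda>\<omega> i. \<xi> i \<omega>) -` ?E \<inter> space M) \<inter> ((\<lambda>\<omega> j. S j \<omega>) -` ?H \<inter> space M)) =
      prob ((\<lambda>\<omega> i. \<xi> i \<omega>) -` ?E \<inter> space M) * prob ((\<lambda>\<omega> j. S j \<omega>) -` ?H \<inter> space M)"
    using scenery_indep unfolding indep_processes_def
    by (rule indep_setD) (intro in_vimage_algebra E H)+
  moreover have "(\<lambda>\<omega> i. \<xi> i \<omega>) -` ?E \<inter> space M = {\<omega> \<in> space M. \<forall>k\<in>A. \<xi> k \<omega> \<le> v}"
    by (auto simp: space_PiM)
  moreover have "(\<lambda>\<omega> j. S j \<omega>) -` ?H \<inter> space M = {\<omega> \<in> space M. sites I \<omega> = A}"
    by (auto simp: space_PiM)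
  moreover have "{\<omega> \<in> space M. \<forall>k\<in>A. \<xi> k \<omega> \<le> v} \<inter> {\<omega> \<in> space M. sites I \<omega> = A} =
      {\<omega> \<in> space M. sites I \<omega> = A \<and> (\<forall>k\<in>A. \<xi> k \<omega> \<le> v)}"
    by blast
  ultimately show ?thesis
    by (simp add: joint_df_def mult.commute)
qed

lemma measurable_F_sites:
  assumes "finite I"
  shows "(\<lambda>\<omega>. F (sites I \<omega>) v) \<in> borel_measurable M"
proof -
  obtain N where N: "I \<subseteq> {..N}"
    using assms finite_nat_iff_bounded_le by blast
  have "(\<lambda>\<omega>. F ((\<lambda>i. traj N \<omega> i) ` I) v) \<in> measurable M (count_space UNIV)"
    using measurable_traj[of "\<lambda>x. F (x ` I) v" N] by simp
  also have "(\<lambda>\<omega>. F ((\<lambda>i. traj N \<omega> i) ` I) v) = (\<lambda>\<omega>. F (sites I \<omega>) v)"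
    using N by (intro ext arg_cong2[where f = F] image_cong) auto
  finally show ?thesis
    by (rule measurable_compose) simp
qed

text \<open>
  Condition on the set of visited sites, which takes countably many values.
\<close>

lemma G_eq_expectation:
  assumes fin: "finite I"
  shows "G I v = expectation (\<lambda>\<omega>. F (sites I \<omega>) v)"
proof -
  let ?C = "{A :: int set. finite A}"
  define E where "E A = {\<omega> \<in> space M. sites I \<omega> = A \<and> (\<forall>k\<in>A. \<xi> k \<omega> \<le> v)}" for A
  have C: "countable ?C"
    using countable_Collect_finite .
  have sites [measurable]: "{\<omega> \<in> space M. sites I \<omega> = A} \<in> events" if "A \<in> ?C" for A
    using sites_event fin that by simp
  have E: "E A \<in> events" if "A \<in> ?C" for A
  proof -
    have "E A = {\<omega> \<in> space M. sites I \<omega> = A} \<inter> {\<omega> \<in> space M. \<forall>k\<in>A. \<xi> k \<omega> \<le> v}"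
      by (auto simp: E_def)
    then show ?thesis
      using sites[OF that] F_event[of A v] that by auto
  qed
  have disj: "disjoint_family_on E ?C"
    by (auto simp: disjoint_family_on_def E_def)
  have "{\<omega> \<in> space M. \<forall>i\<in>I. \<xi> (S i \<omega>) \<omega> \<le> v} = (\<Union>A\<in>?C. E A)"
    using fin by (auto simp: E_def)
  then have "emeasure M {\<omega> \<in> space M. \<forall>i\<in>I. \<xi> (S i \<omega>) \<omega> \<le> v} = (\<integral>\<^sup>+A. emeasure M (E A) \<partial>count_space ?C)"
    using emeasure_UN_countable[OF E C disj] by simp
  also have "\<dots> = (\<integral>\<^sup>+A. \<integral>\<^sup>+\<omega>. ennreal (F A v) * indicator {\<omega> \<in> space M. sites I \<omega> = A} \<omega> \<partial>M \<partial>count_space ?C)"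
  proof (rule nn_integral_cong)
    fix A assume "A \<in> space (count_space ?C)"
    then have A: "A \<in> ?C" by simp
    have "emeasure M (E A) = ennreal (F A v) * emeasure M {\<omega> \<in> space M. sites I \<omega> = A}"
      using prob_sites_and_scenery[OF fin, of A v] A F_nonneg[of A v]
      by (simp add: emeasure_eq_measure E_def mult.commute ennreal_mult')
    then show "emeasure M (E A) = (\<integral>\<^sup>+\<omega>. ennreal (F A v) * indicator {\<omega> \<in> space M. sites I \<omega> = A} \<omega> \<partial>M)"
      using sites[OF A] by (simp add: nn_integral_cmult_indicator)
  qed
  also have "\<dots> = (\<integral>\<^sup>+\<omega>. \<integral>\<^sup>+A. ennreal (F A v) * indicator {\<omega> \<in> space M. sites I \<omega> = A} \<omega> \<partial>count_space ?C \<partial>M)"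
    using sites by (intro nn_integral_count_space_nn_integral[symmetric] C) auto
  also have "\<dots> = (\<integral>\<^sup>+\<omega>. ennreal (F (sites I \<omega>) v) \<partial>M)"
  proof (rule nn_integral_cong)
    fix \<omega> assume \<omega>: "\<omega> \<in> space M"
    show "(\<integral>\<^sup>+A. ennreal (F A v) * indicator {\<omega> \<in> space M. sites I \<omega> = A} \<omega> \<partial>count_space ?C) =
        ennreal (F (sites I \<omega>) v)"
      using fin \<omega> by (subst nn_integral_count_space'[where A = "{sites I \<omega>}"]) auto
  qed
  also have "\<dots> = ennreal (expectation (\<lambda>\<omega>. F (sites I \<omega>) v))"
    using F_nonneg F_le_1 measurable_F_sites[OF fin]
    by (intro nn_integral_eq_integral integrable_const_bound[where B = 1]) auto
  finally show ?thesis
    using F_nonneg unfolding joint_df_def by (simp add: measure_def integral_nonneg_AE)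
qed

lemma integrable_F_sites: "finite I \<Longrightarrow> integrable M (\<lambda>\<omega>. F (sites I \<omega>) v)"
  using F_nonneg F_le_1 measurable_F_sites by (intro integrable_const_bound[where B = 1]) auto

lemma G_nonneg: "0 \<le> G I v"
  by (simp add: joint_df_def)

lemma G_le_1: "G I v \<le> 1"
  by (simp add: joint_df_def)

lemma G_antimono:
  assumes "finite J" "I \<subseteq> J"
  shows "G J v \<le> G I v"
proof -
  have "finite I" using assms finite_subset by blast
  then show ?thesis
    unfolding G_eq_expectation[OF \<open>finite J\<close>] G_eq_expectation[OF \<open>finite I\<close>]
    using assms by (intro integral_mono integrable_F_sites F_antimono) auto
qed

text \<open>
  The sites visited during \<open>J\<close>, seen from the position at time \<open>m\<close>, are a function of the increments after \<open>m\<close>,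
  hence independent of those visited during \<open>I\<close>. Stationarity of the scenery removes the dependence of
  \<open>F\<close> on the position at time \<open>m\<close>.
\<close>

lemma G_mult_eq_expectation:
  assumes fin: "finite I" "finite J" and le: "\<And>i. i \<in> I \<Longrightarrow> i \<le> m" "\<And>j. j \<in> J \<Longrightarrow> m \<le> j"
  shows "G I v * G J v = expectation (\<lambda>\<omega>. F (sites I \<omega>) v * F (sites J \<omega>) v)"
proof -
  obtain N where N: "J \<subseteq> {..N}"
    using fin(2) finite_nat_iff_bounded_le by blast
  let ?f = "\<lambda>x. F (x ` I) v" and ?g = "\<lambda>x. F ((\<lambda>j. x (j - m)) ` J) v"
  have f: "?f (traj m \<omega>) = F (sites I \<omega>) v" for \<omega>
    using le by (intro arg_cong2[where f = F] image_cong) auto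
  have g: "?g (traj_from m N \<omega>) = F (sites J \<omega>) v" for \<omega>
  proof -
    have "(\<lambda>j. traj_from m N \<omega> (j - m)) ` J = (\<lambda>k. k + (- S m \<omega>)) ` sites J \<omega>"
      unfolding image_image using le N by (intro image_cong) (auto simp: subset_iff)
    then show ?thesis
      using fin by (simp only: F_shift finite_imageI)
  qed
  have "indep_var borel ((\<lambda>x. x) \<circ> (\<lambda>\<omega>. ?f (traj m \<omega>))) borel ((\<lambda>x. x) \<circ> (\<lambda>\<omega>. ?g (traj_from m N \<omega>)))"
    by (rule indep_var_compose[OF indep_traj_from]) auto
  then have "indep_var borel (\<lambda>\<omega>. F (sites I \<omega>) v) borel (\<lambda>\<omega>. F (sites J \<omega>) v)"
    unfolding f g comp_def .
  from indep_var_lebesgue_integral[OF this integrable_F_sites integrable_F_sites] fin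
  show ?thesis
    by (simp add: G_eq_expectation)
qed

lemma measurable_close [measurable]: "Measurable.pred M (\<lambda>\<omega>. \<bar>S j \<omega> - S i \<omega>\<bar> < int g)"
  using measurable_traj[of "\<lambda>x. \<bar>x j - x i\<bar> < int g" "max i j"] by simp

text \<open>
  Seen from time \<open>i\<close>, a copy of the walk has to come close to the origin after time \<open>g\<close>.
\<close>

lemma prob_close_le:
  fixes \<delta> :: real
  assumes \<delta>: "\<And>N. prob {\<omega> \<in> space M. \<exists>m\<in>{g..N}. \<bar>S m \<omega>\<bar> < int g} \<le> \<delta>"
    and "finite J" "\<And>j. j \<in> J \<Longrightarrow> i + g \<le> j"
  shows "prob {\<omega> \<in> space M. \<exists>j\<in>J. \<bar>S j \<omega> - S i \<omega>\<bar> < int g} \<le> \<delta>"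
proof -
  obtain N where N: "J \<subseteq> {..N}"
    using assms(2) finite_nat_iff_bounded_le by blast
  have "prob {\<omega> \<in> space M. \<exists>j\<in>J. \<bar>S j \<omega> - S i \<omega>\<bar> < int g} \<le>
      prob {\<omega> \<in> space M. \<exists>m\<in>{g..N}. \<bar>traj_from i N \<omega> m\<bar> < int g}"
  proof (rule finite_measure_mono)
    show "{\<omega> \<in> space M. \<exists>j\<in>J. \<bar>S j \<omega> - S i \<omega>\<bar> < int g} \<subseteq>
        {\<omega> \<in> space M. \<exists>m\<in>{g..N}. \<bar>traj_from i N \<omega> m\<bar> < int g}"
    proof
      fix \<omega> assume "\<omega> \<in> {\<omega> \<in> space M. \<exists>j\<in>J. \<bar>S j \<omega> - S i \<omega>\<bar> < int g}"
      then obtain j where j: "\<omega> \<in> space M" "j \<in> J" "\<bar>S j \<omega> - S i \<omega>\<bar> < int g" by blast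
      have "i + g \<le> j" "j \<le> N"
        using assms(3)[OF j(2)] N j(2) by auto
      then have *: "g \<le> j - i" "j - i \<le> N" "i + (j - i) = j"
        by linarith+
      then have "j - i \<in> {g..N}" "\<bar>traj_from i N \<omega> (j - i)\<bar> < int g"
        using j(3) by simp_all
      then show "\<omega> \<in> {\<omega> \<in> space M. \<exists>m\<in>{g..N}. \<bar>traj_from i N \<omega> m\<bar> < int g}"
        using j(1) by blast
    qed
    have "{\<omega> \<in> space M. \<exists>m\<in>{g..N}. \<bar>traj_from i N \<omega> m\<bar> < int g} =
        {\<omega> \<in> space M. \<exists>m\<in>{g..N}. \<bar>S (i + m) \<omega> - S i \<omega>\<bar> < int g}"
      by (intro Collect_cong conj_cong bex_cong) auto
    also have "\<dots> \<in> events" by measurable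
    finally show "{\<omega> \<in> space M. \<exists>m\<in>{g..N}. \<bar>traj_from i N \<omega> m\<bar> < int g} \<in> events" .
  qed
  also have "\<dots> = prob {\<omega> \<in> space M. \<exists>m\<in>{g..N}. \<bar>traj N \<omega> m\<bar> < int g}"
    by (rule prob_traj_from)
  also have "{\<omega> \<in> space M. \<exists>m\<in>{g..N}. \<bar>traj N \<omega> m\<bar> < int g} = {\<omega> \<in> space M. \<exists>m\<in>{g..N}. \<bar>S m \<omega>\<bar> < int g}"
    by (intro Collect_cong conj_cong bex_cong) auto
  also have "prob \<dots> \<le> \<delta>" by (rule \<delta>)
  finally show ?thesis .
qed

lemma expectation_count_le:
  fixes \<delta> :: real
  assumes "finite I" and [measurable]: "\<And>i. i \<in> I \<Longrightarrow> Measurable.pred M (Q i)"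
    and "\<And>i. i \<in> I \<Longrightarrow> prob {\<omega> \<in> space M. Q i \<omega>} \<le> \<delta>"
  shows "integrable M (\<lambda>\<omega>. \<Sum>i\<in>I. of_bool (Q i \<omega>) :: real)"
    and "expectation (\<lambda>\<omega>. \<Sum>i\<in>I. of_bool (Q i \<omega>)) \<le> card I * \<delta>"
proof -
  have *: "integrable M (\<lambda>\<omega>. of_bool (Q i \<omega>) :: real)" "expectation (\<lambda>\<omega>. of_bool (Q i \<omega>)) = prob {\<omega> \<in> space M. Q i \<omega>}"
    if "i \<in> I" for i
  proof -
    have [measurable]: "Measurable.pred M (Q i)" using assms(2)[OF that] .
    show "integrable M (\<lambda>\<omega>. of_bool (Q i \<omega>) :: real)"
      by (intro integrable_const_bound[where B = 1]) auto
    have "expectation (\<lambda>\<omega>. of_bool (Q i \<omega>) :: real) = expectation (indicator {\<omega> \<in> space M. Q i \<omega>})"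
      by (intro Bochner_Integration.integral_cong) auto
    then show "expectation (\<lambda>\<omega>. of_bool (Q i \<omega>)) = prob {\<omega> \<in> space M. Q i \<omega>}"
      by (auto intro!: arg_cong[where f = prob])
  qed
  then show "integrable M (\<lambda>\<omega>. \<Sum>i\<in>I. of_bool (Q i \<omega>) :: real)"
    by (intro Bochner_Integration.integrable_sum) auto
  have "expectation (\<lambda>\<omega>. \<Sum>i\<in>I. of_bool (Q i \<omega>)) = (\<Sum>i\<in>I. prob {\<omega> \<in> space M. Q i \<omega>})"
    using * by (subst Bochner_Integration.integral_sum) auto
  also have "\<dots> \<le> card I * \<delta>"
    using assms(3) by (intro sum_bounded_above) auto
  finally show "expectation (\<lambda>\<omega>. \<Sum>i\<in>I. of_bool (Q i \<omega>)) \<le> card I * \<delta>" .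
qed

text \<open>
  Some residue class modulo \<open>g\<close> contains at least \<open>2 * R\<close> of the times, and the members of a residue class
  are separated by gaps of length at least \<open>g\<close>. So each of them is followed by a return to
  within distance \<open>g\<close> of the same site with probability at most \<open>\<delta>\<close>. When at most half of them are, at least \<open>R\<close> distinct sites
  are visited and \<open>F\<close> is at most \<open>e\<close>; the other event is estimated by Markov's inequality.
\<close>

lemma G_le_of_many_times:
  fixes \<delta> :: real
  assumes \<delta>: "\<And>N. prob {\<omega> \<in> space M. \<exists>m\<in>{g..N}. \<bar>S m \<omega>\<bar> < int g} \<le> \<delta>"
    and g: "0 < g" and R: "0 < R" and fin: "finite I" and card_I: "g * (2 * R) \<le> card I"
    and F_le: "\<And>A. finite A \<Longrightarrow> R \<le> card A \<Longrightarrow> F A v \<le> e" and e: "0 \<le> e"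
  shows "G I v \<le> e + 2 * \<delta>"
proof -
  obtain r where r: "2 * R \<le> card {i \<in> I. i mod g = r}"
  proof (rule ccontr)
    assume "\<not> thesis"
    then have less: "card {i \<in> I. i mod g = r} < 2 * R" for r
      using that not_le by blast
    have "card I = card (\<Union>r\<in>{..<g}. {i \<in> I. i mod g = r})"
      using g by (intro arg_cong[where f = card]) auto
    also have "\<dots> \<le> (\<Sum>r<g. card {i \<in> I. i mod g = r})"
      by (intro card_UN_le) simp
    also have "\<dots> < (\<Sum>r<g. 2 * R)"
      using g less by (intro sum_strict_mono) auto
    finally show False using card_I by simp
  qed
  define I' where "I' = {i \<in> I. i mod g = r}"
  have fin': "finite I'" and sub: "I' \<subseteq> I" and card: "2 * R \<le> card I'"
    using fin r by (auto simp: I'_def)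
  have sep: "i + g \<le> j" if ij: "i \<in> I'" "j \<in> I'" "i < j" for i j
  proof -
    have "g dvd j - i"
      using ij mod_eq_dvd_iff_nat[of i j g] by (simp add: I'_def)
    then show ?thesis
      using ij(3) dvd_imp_le[of g "j - i"] by simp
  qed
  define Q where "Q i \<omega> \<longleftrightarrow> (\<exists>j\<in>{j \<in> I'. i < j}. \<bar>S j \<omega> - S i \<omega>\<bar> < int g)" for i \<omega>
  have Q_meas: "Measurable.pred M (Q i)" for i
    unfolding Q_def using fin' by measurable
  have Q_prob: "prob {\<omega> \<in> space M. Q i \<omega>} \<le> \<delta>" if "i \<in> I'" for i
    unfolding Q_def using fin' sep that by (intro prob_close_le \<delta>) auto
  have pos: "0 < real (card I')"
    using card R by simp
  have le: "F (sites I' \<omega>) v \<le> e + 2 / card I' * (\<Sum>i\<in>I'. of_bool (Q i \<omega>))" for \<omega>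
  proof -
    define K where "K = {i \<in> I'. Q i \<omega>}"
    have K: "finite K" "K \<subseteq> I'" "(\<Sum>i\<in>I'. of_bool (Q i \<omega>)) = real (card K)"
      using fin' by (auto simp: K_def sum.If_cases of_bool_def Int_def)
    show ?thesis
    proof (cases "2 * card K \<le> card I'")
      case True
      have "S i \<omega> \<noteq> S j \<omega>" if "i \<in> I' - K" "j \<in> I' - K" "i < j" for i j
        using that g by (auto simp: K_def Q_def)
      then have "inj_on (\<lambda>i. S i \<omega>) (I' - K)"
        by (intro linorder_inj_onI') metis
      then have "card (sites (I' - K) \<omega>) = card I' - card K"
        using K by (simp add: card_image card_Diff_subset)
      then have "R \<le> card (sites (I' - K) \<omega>)"
        using True card by linarith
      also have "\<dots> \<le> card (sites I' \<omega>)"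
        using fin' by (intro card_mono) auto
      finally have "F (sites I' \<omega>) v \<le> e"
        using fin' by (intro F_le) auto
      then show ?thesis
        using pos K by (simp add: add_increasing2)
    next
      case False
      then have "1 \<le> 2 / card I' * real (card K)"
        using pos by (simp add: field_simps)
      then show ?thesis
        unfolding K(3) using F_le_1[of "sites I' \<omega>" v] e by linarith
    qed
  qed
  note count = expectation_count_le[OF fin' Q_meas Q_prob]
  have "G I v \<le> G I' v"
    using fin sub by (intro G_antimono)
  also have "\<dots> \<le> expectation (\<lambda>\<omega>. e + 2 / card I' * (\<Sum>i\<in>I'. of_bool (Q i \<omega>)))"
    unfolding G_eq_expectation[OF fin'] using le count(1)
    by (intro integral_mono integrable_F_sites fin' Bochner_Integration.integrable_add integrable_mult_right) auto
  also have "\<dots> = e + 2 / card I' * expectation (\<lambda>\<omega>. \<Sum>i\<in>I'. of_bool (Q i \<omega>))"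
    using count(1) by (subst Bochner_Integration.integral_add) (auto simp: prob_space)
  also have "\<dots> \<le> e + 2 / card I' * (card I' * \<delta>)"
    using count(2) by (intro add_left_mono mult_left_mono) auto
  also have "\<dots> = e + 2 * \<delta>"
    using pos by simp
  finally show ?thesis .
qed

text \<open>
  The points discarded are the sites visited during \<open>I\<close>. Counting them by the times of visit bounds their
  expected number by \<open>card I * \<delta>\<close>.
\<close>

lemma G_mixing:
  fixes \<delta> :: real
  assumes "mixing_level M \<xi> v l a"
    and \<delta>: "\<And>N. prob {\<omega> \<in> space M. \<exists>m\<in>{g..N}. \<bar>S m \<omega>\<bar> < int g} \<le> \<delta>"
    and "l \<le> g" and fin: "finite I" "finite J" and sep: "\<And>i j. i \<in> I \<Longrightarrow> j \<in> J \<Longrightarrow> i + g \<le> j"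
  shows "\<bar>G (I \<union> J) v - G I v * G J v\<bar> \<le>
    card I * \<delta> * prob {\<omega> \<in> space M. v < \<xi> 0 \<omega>} + 2 * real (card I + card J) * a"
proof -
  interpret level: mixing_level M \<xi> v l a by fact
  let ?p = "prob {\<omega> \<in> space M. v < \<xi> 0 \<omega>}"
  define Q where "Q i \<omega> \<longleftrightarrow> (\<exists>j\<in>J. \<bar>S j \<omega> - S i \<omega>\<bar> < int g)" for i \<omega>
  have Q_meas: "Measurable.pred M (Q i)" for i
    unfolding Q_def using fin by measurable
  have Q_prob: "prob {\<omega> \<in> space M. Q i \<omega>} \<le> \<delta>" if "i \<in> I" for i
    unfolding Q_def using fin sep that by (intro prob_close_le \<delta>) auto
  note count = expectation_count_le[OF fin(1) Q_meas Q_prob]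
  have pointwise: "\<bar>F (sites (I \<union> J) \<omega>) v - F (sites I \<omega>) v * F (sites J \<omega>) v\<bar> \<le>
      (\<Sum>i\<in>I. of_bool (Q i \<omega>)) * ?p + 2 * real (card I + card J) * a" for \<omega>
  proof -
    let ?A = "sites J \<omega>" and ?B = "sites I \<omega>"
    have "{y \<in> ?B. \<exists>x\<in>?A. \<bar>x - y\<bar> < int l} \<subseteq> (\<lambda>i. S i \<omega>) ` {i \<in> I. Q i \<omega>}"
    proof
      fix y assume "y \<in> {y \<in> ?B. \<exists>x\<in>?A. \<bar>x - y\<bar> < int l}"
      then obtain i j where ij: "i \<in> I" "j \<in> J" "y = S i \<omega>" "\<bar>S j \<omega> - S i \<omega>\<bar> < int l"
        by auto
      then have "\<bar>S j \<omega> - S i \<omega>\<bar> < int g"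
        using \<open>l \<le> g\<close> by linarith
      then show "y \<in> (\<lambda>i. S i \<omega>) ` {i \<in> I. Q i \<omega>}"
        using ij by (auto simp: Q_def)
    qed
    then have "card {y \<in> ?B. \<exists>x\<in>?A. \<bar>x - y\<bar> < int l} \<le> card {i \<in> I. Q i \<omega>}"
      using fin by (intro surj_card_le) auto
    also have "real (card {i \<in> I. Q i \<omega>}) = (\<Sum>i\<in>I. of_bool (Q i \<omega>))"
      using fin by (simp add: sum.If_cases of_bool_def Int_def)
    finally have close: "real (card {y \<in> ?B. \<exists>x\<in>?A. \<bar>x - y\<bar> < int l}) \<le> (\<Sum>i\<in>I. of_bool (Q i \<omega>))"
      by simp
    have "\<bar>F (?A \<union> ?B) v - F ?A v * F ?B v\<bar> \<le>
        card {y \<in> ?B. \<exists>x\<in>?A. \<bar>x - y\<bar> < int l} * level.tail_prob + 2 * real (card ?A + card ?B) * a"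
      using fin by (intro level.mixing_up_to_close_points) auto
    also have "\<dots> \<le> (\<Sum>i\<in>I. of_bool (Q i \<omega>)) * ?p + 2 * real (card I + card J) * a"
      using close card_image_le[OF fin(1), of "\<lambda>i. S i \<omega>"] card_image_le[OF fin(2), of "\<lambda>i. S i \<omega>"]
        level.error_nonneg
      unfolding level.tail_prob_def by (intro add_mono mult_mono) auto
    finally show ?thesis
      by (simp add: image_Un Un_commute mult.commute)
  qed
  obtain m where m: "\<And>i. i \<in> I \<Longrightarrow> i \<le> m" "\<And>j. j \<in> J \<Longrightarrow> m \<le> j"
  proof (cases "I = {}")
    case True
    then show thesis using that[of 0] by auto
  next
    case False
    then show thesis
    proof (rule_tac that[of "Max I"])
      fix j assume "j \<in> J"
      then have "Max I + g \<le> j"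
        using sep[of "Max I" j] False fin by simp
      then show "Max I \<le> j" by (rule add_leD1)
    qed (use fin in simp)
  qed
  have int: "integrable M (\<lambda>\<omega>. F (sites I \<omega>) v * F (sites J \<omega>) v)"
    using F_nonneg F_le_1 fin
    by (intro integrable_const_bound[where B = 1] borel_measurable_times measurable_F_sites)
       (auto intro!: mult_le_one)
  have "G (I \<union> J) v - G I v * G J v =
      expectation (\<lambda>\<omega>. F (sites (I \<union> J) \<omega>) v - F (sites I \<omega>) v * F (sites J \<omega>) v)"
    using fin int G_mult_eq_expectation[OF fin m]
    by (subst Bochner_Integration.integral_diff) (auto simp: G_eq_expectation integrable_F_sites)
  also have "\<bar>\<dots>\<bar> \<le> expectation (\<lambda>\<omega>. \<bar>F (sites (I \<union> J) \<omega>) v - F (sites I \<omega>) v * F (sites J \<omega>) v\<bar>)"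
    by (rule integral_abs_bound)
  also have "\<dots> \<le> expectation (\<lambda>\<omega>. (\<Sum>i\<in>I. of_bool (Q i \<omega>)) * ?p + 2 * real (card I + card J) * a)"
    using pointwise fin int count(1)
    by (intro integral_mono integrable_abs Bochner_Integration.integrable_diff integrable_F_sites
        Bochner_Integration.integrable_add integrable_mult_left) auto
  also have "\<dots> = expectation (\<lambda>\<omega>. \<Sum>i\<in>I. of_bool (Q i \<omega>)) * ?p + 2 * real (card I + card J) * a"
    using count(1) by (subst Bochner_Integration.integral_add) (auto simp: prob_space)
  also have "\<dots> \<le> card I * \<delta> * ?p + 2 * real (card I + card J) * a"
    by (intro add_right_mono mult_right_mono count(2)) simp_all
  finally show ?thesis .
qed

end

text \<open>
  The threshold \<open>L * n\<close> separates the two regimes. Above it one of the two time sets makes all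
  probabilities at most \<open>\<epsilon> / 2\<close>. Below it both error terms of \<open>G_mixing\<close> are at most a multiple of \<open>n\<close> times
  something that is \<open>o(1/n)\<close>. The escape property is used twice: with a fixed gap, on which \<open>L\<close> depends, to count distinct
  sites; and with the growing gap \<open>g n\<close> and a smaller probability \<open>\<delta>\<close>, chosen after \<open>L\<close>, to count close points.
\<close>

lemma (in walk_in_scenery) discrepancy_eventually_small:
  assumes transient: "\<And>\<epsilon>. 0 < \<epsilon> \<Longrightarrow>
      \<exists>g0. \<forall>g\<ge>g0. \<forall>N. prob {\<omega> \<in> space M. \<exists>m\<in>{g..N}. \<bar>S m \<omega>\<bar> < int g} \<le> \<epsilon>"
    and tau: "0 < \<tau>" and tail: "(\<lambda>n. real n * prob {\<omega> \<in> space M. \<xi> 0 \<omega> > u n}) \<longlonglongrightarrow> \<tau>"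
    and D: "D_cond_with M \<xi> u a l" and D': "D'_cond_with M \<xi> u a l"
    and g: "filterlim g at_top sequentially" "\<And>n. l n \<le> g n" and eps: "0 < \<epsilon>"
  shows "\<forall>\<^sub>F n in sequentially. \<forall>I J. finite I \<longrightarrow> finite J \<longrightarrow> (\<forall>i\<in>I. \<forall>j\<in>J. i + g n \<le> j) \<longrightarrow>
    \<bar>G (I \<union> J) (u n) - G I (u n) * G J (u n)\<bar> \<le> \<epsilon>"
proof -
  define p where "p n = prob {\<omega> \<in> space M. u n < \<xi> 0 \<omega>}" for n
  have level: "mixing_level M \<xi> (u n) (l n) (a n (l n))" for n
    by (rule mixing_level_of_D[OF D])
  obtain g0 where g0: "\<forall>g\<ge>g0. \<forall>N. prob {\<omega> \<in> space M. \<exists>m\<in>{g..N}. \<bar>S m \<omega>\<bar> < int g} \<le> \<epsilon> / 8"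
    using transient[of "\<epsilon> / 8"] eps by auto
  define g1 where "g1 = max 1 g0"
  have g1: "prob {\<omega> \<in> space M. \<exists>m\<in>{g1..N}. \<bar>S m \<omega>\<bar> < int g1} \<le> \<epsilon> / 8" "0 < g1" for N
    using g0 by (auto simp: g1_def)
  have "0 < \<epsilon> / 4" using eps by simp
  from F_large_sets_small[OF tau tail D D' this] obtain K where K: "0 < K"
    and large: "\<forall>\<^sub>F n in sequentially. \<forall>A. finite A \<longrightarrow> K * n \<le> card A \<longrightarrow> F A (u n) \<le> \<epsilon> / 4"
    by blast
  define L where "L = g1 * (2 * K)"
  define \<delta> where "\<delta> = \<epsilon> / (4 * L * (\<tau> + 1))"
  have L: "0 < L" and \<delta>: "0 < \<delta>"
    using g1(2) K eps tau by (auto simp: L_def \<delta>_def)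
  obtain g2 where g2: "\<forall>g\<ge>g2. \<forall>N. prob {\<omega> \<in> space M. \<exists>m\<in>{g..N}. \<bar>S m \<omega>\<bar> < int g} \<le> \<delta>"
    using transient[OF \<delta>] by blast
  have "\<forall>\<^sub>F n in sequentially. g2 \<le> g n"
    using g(1) by (simp add: filterlim_at_top)
  moreover have "\<forall>\<^sub>F n in sequentially. real n * p n < \<tau> + 1"
    using tail by (intro order_tendstoD(2)[of _ \<tau>]) (simp_all add: p_def)
  moreover have "\<forall>\<^sub>F n in sequentially. real n * a n (l n) < \<epsilon> / (8 * L)"
    using scaled_error_tendsto_0[OF D D'] by (rule order_tendstoD) (use eps L in simp)
  ultimately show ?thesis
    using large eventually_gt_at_top[of 0]
  proof eventually_elim
    case (elim n)
    note gn = elim(1) and pn = elim(2) and an = elim(3) and large = elim(4) and n = elim(5)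
    have sparse: "G I (u n) \<le> \<epsilon> / 2" if "finite I" "L * n \<le> card I" for I
    proof -
      have "G I (u n) \<le> \<epsilon> / 4 + 2 * (\<epsilon> / 8)"
      proof (rule G_le_of_many_times[OF g1])
        show "0 < K * n" using K n by simp
        show "g1 * (2 * (K * n)) \<le> card I"
          using that by (simp add: L_def mult_ac)
        show "F A (u n) \<le> \<epsilon> / 4" if "finite A" "K * n \<le> card A" for A
          using large that by blast
      qed (use that eps in auto)
      then show ?thesis by simp
    qed
    show ?case
    proof (intro allI impI)
      fix I J assume fin: "finite I" "finite J" and sep: "\<forall>i\<in>I. \<forall>j\<in>J. i + g n \<le> j"
      show "\<bar>G (I \<union> J) (u n) - G I (u n) * G J (u n)\<bar> \<le> \<epsilon>"
      proof (cases "L * n \<le> card I \<or> L * n \<le> card J")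
        case True
        have prod: "G I (u n) * G J (u n) \<le> G I (u n)" "G I (u n) * G J (u n) \<le> G J (u n)"
          using G_nonneg[of I "u n"] G_nonneg[of J "u n"] G_le_1[of I "u n"] G_le_1[of J "u n"]
          by (auto intro: mult_left_le mult_left_le_one_le)
        have union: "G (I \<union> J) (u n) \<le> G I (u n)" "G (I \<union> J) (u n) \<le> G J (u n)"
          using fin by (auto intro!: G_antimono)
        have "G (I \<union> J) (u n) \<le> \<epsilon> / 2 \<and> G I (u n) * G J (u n) \<le> \<epsilon> / 2"
        proof (cases "L * n \<le> card I")
          case I: True
          show ?thesis using sparse[OF fin(1) I] prod(1) union(1) by linarith
        next
          case False
          then have J: "L * n \<le> card J" using True by simp
          show ?thesis using sparse[OF fin(2) J] prod(2) union(2) by linarith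
        qed
        moreover have "0 \<le> G (I \<union> J) (u n)" "0 \<le> G I (u n) * G J (u n)"
          by (simp_all add: G_nonneg)
        ultimately show ?thesis
          unfolding abs_le_iff using eps by linarith
      next
        case False
        then have small: "real (card I) \<le> real (L * n)" "real (card I + card J) \<le> real (2 * (L * n))"
          by (simp_all only: of_nat_le_iff) linarith+
        have "\<bar>G (I \<union> J) (u n) - G I (u n) * G J (u n)\<bar> \<le>
            card I * \<delta> * p n + 2 * real (card I + card J) * a n (l n)"
          unfolding p_def using g2 gn sep fin g(2) by (intro G_mixing[OF level]) auto
        also have "\<dots> \<le> real (L * n) * \<delta> * p n + 2 * real (2 * (L * n)) * a n (l n)"
          using small \<delta> mixing_level.error_nonneg[OF level, of n]
          by (intro add_mono mult_right_mono mult_left_mono) (auto simp: p_def)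
        also have "\<dots> = L * \<delta> * (real n * p n) + 4 * L * (real n * a n (l n))"
          by simp
        also have "\<dots> \<le> L * \<delta> * (\<tau> + 1) + 4 * L * (\<epsilon> / (8 * L))"
          using pn an \<delta> by (intro add_mono mult_left_mono) auto
        also have "L * \<delta> * (\<tau> + 1) = \<epsilon> / 4"
        proof -
          have "L * (\<epsilon> / (4 * L * t)) * t = \<epsilon> / 4" if "t \<noteq> 0" for t :: real
            using L that by simp
          from this[of "\<tau> + 1"] tau show ?thesis
            unfolding \<delta>_def by linarith
        qed
        also have "4 * L * (\<epsilon> / (8 * L)) = \<epsilon> / 2"
          using L by simp
        finally show ?thesis using eps by simp
      qed
    qed
  qed
qed

text \<open>
  The optimal coefficients are the suprema of the discrepancies over all admissible pairs of index sets.
\<close>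

lemma D_cond_of_eventually_small:
  fixes \<zeta> :: "nat \<Rightarrow> 'a \<Rightarrow> real"
  assumes "prob_space M" and g: "\<And>n. 0 < g n" "(\<lambda>n. real (g n)) \<in> o(\<lambda>n. real n)"
    and small: "\<And>\<epsilon>. 0 < \<epsilon> \<Longrightarrow> \<forall>\<^sub>F n in sequentially. \<forall>I J. finite I \<longrightarrow> finite J \<longrightarrow>
      (\<forall>i\<in>I. \<forall>j\<in>J. i + g n \<le> j) \<longrightarrow>
      \<bar>joint_df M \<zeta> (I \<union> J) (u n) - joint_df M \<zeta> I (u n) * joint_df M \<zeta> J (u n)\<bar> \<le> \<epsilon>"
  shows "D_cond M \<zeta> u"
proof -
  interpret prob_space M by fact
  define d where "d n I J = \<bar>joint_df M \<zeta> (I \<union> J) (u n) - joint_df M \<zeta> I (u n) * joint_df M \<zeta> J (u n)\<bar>" for n I J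
  define admissible where "admissible m = {(I, J). finite I \<and> I \<noteq> {} \<and> finite J \<and> J \<noteq> {} \<and>
    Max I < Min J \<and> Max I + m \<le> Min J}" for m :: nat
  define a where "a n m = (SUP (I, J)\<in>admissible m. d n I J)" for n m
  have d_le_1: "d n I J \<le> 1" for n I J
  proof -
    have "0 \<le> joint_df M \<zeta> A (u n)" "joint_df M \<zeta> A (u n) \<le> 1" for A
      by (simp_all add: joint_df_def)
    then show ?thesis
      unfolding d_def using mult_le_one[of "joint_df M \<zeta> I (u n)" "joint_df M \<zeta> J (u n)"]
      by (smt (verit) mult_nonneg_nonneg)
  qed
  have bdd: "bdd_above ((\<lambda>(I, J). d n I J) ` admissible m)" for n m
    by (rule bdd_aboveI2[of _ _ 1]) (auto simp: d_le_1)
  have upper: "d n I J \<le> a n m" if "(I, J) \<in> admissible m" for n m I J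
    unfolding a_def using cSUP_upper[OF that bdd] by simp
  have nonempty: "({0}, {Suc m}) \<in> admissible m" for m
    by (simp add: admissible_def)
  have "(\<lambda>n. a n (g n)) \<longlonglongrightarrow> 0"
  proof (rule tendstoI)
    fix e :: real assume e: "0 < e"
    from small[of "e / 2"] e have "\<forall>\<^sub>F n in sequentially. \<forall>I J. finite I \<longrightarrow> finite J \<longrightarrow>
      (\<forall>i\<in>I. \<forall>j\<in>J. i + g n \<le> j) \<longrightarrow> d n I J \<le> e / 2"
      by (simp add: d_def)
    then show "\<forall>\<^sub>F n in sequentially. dist (a n (g n)) 0 < e"
    proof eventually_elim
      case (elim n)
      have "a n (g n) \<le> e / 2"
        unfolding a_def
      proof (rule cSUP_least)
        show "admissible (g n) \<noteq> {}" using nonempty by blast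
        fix x assume "x \<in> admissible (g n)"
        then obtain I J where x: "x = (I, J)" and IJ: "finite I" "finite J" "I \<noteq> {}" "J \<noteq> {}" "Max I + g n \<le> Min J"
          unfolding admissible_def by blast
        have "i + g n \<le> j" if "i \<in> I" "j \<in> J" for i j
          using IJ that Max_ge[of I i] Min_le[of J j] by linarith
        then show "(case x of (I, J) \<Rightarrow> d n I J) \<le> e / 2"
          using elim IJ x by simp
      qed
      moreover have "0 \<le> a n (g n)"
        using order_trans[OF _ upper[OF nonempty]] by (simp add: d_def)
      ultimately show ?case using e by simp
    qed
  qed
  then have "D_cond_with M \<zeta> u a g"
    unfolding D_cond_with_def using g upper by (auto simp: admissible_def d_def)
  then show ?thesis
    unfolding D_cond_def by blast
qed

section \<open>Mixing of the scenery seen along the walk\<close>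

theorem theorem9:
  fixes M :: "'a measure"
    and X :: "nat \<Rightarrow> 'a \<Rightarrow> int"
    and \<xi> :: "int \<Rightarrow> 'a \<Rightarrow> real"
    and \<mu> :: "real measure"
    and \<alpha> C1 C2 \<tau> :: real
    and u :: "nat \<Rightarrow> real"
    and a :: "nat \<Rightarrow> nat \<Rightarrow> real"
    and l :: "nat \<Rightarrow> nat"
  assumes prob: "prob_space M"
    and X_indep: "prob_space.indep_vars M (\<lambda>_. count_space UNIV) X {1..}"
    and X_ident: "\<And>k. k \<ge> 1 \<Longrightarrow>
          distr M (count_space UNIV) (X k) = distr M (count_space UNIV) (X 1)"
    and X_centered: "integrable M (\<lambda>\<omega>. real_of_int (X 1 \<omega>)) \<Longrightarrow>
          (\<integral>\<omega>. real_of_int (X 1 \<omega>) \<partial>M) = 0"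
    and stable: "stable_law \<alpha> C1 C2 \<mu>"
    and X_conv: "\<And>x. (\<lambda>n. measure M {\<omega> \<in> space M.
          real_of_int (walk X n \<omega>) / real n powr (1 / \<alpha>) \<le> x}) \<longlonglongrightarrow> cdf \<mu> x"
    and alpha_less: "\<alpha> < 1"
    and stationary: "strictly_stationary M \<xi>"
    and scenery_indep: "indep_processes M
          (\<lambda>_. borel) \<xi> (\<lambda>_. count_space UNIV) (walk X)"
    and tau_pos: "\<tau> > 0"
    and tail: "(\<lambda>n. real n * measure M {\<omega> \<in> space M. \<xi> 0 \<omega> > u n}) \<longlonglongrightarrow> \<tau>"
    and D: "D_cond_with M \<xi> u a l"
    and D': "D'_cond_with M \<xi> u a l"
  shows "D_cond M (\<lambda>(n::nat) \<omega>. \<xi> (walk X n \<omega>) \<omega>) u"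
proof -
  interpret prob_space M by (rule prob)
  have walk: "iid_walk M X"
    by unfold_locales (fact X_indep, rule X_ident)
  then interpret stable_walk M X \<alpha> C1 C2 \<mu>
    by (rule stable_walk.intro) (rule stable_walk_axioms.intro[OF stable alpha_less X_conv])
  interpret walk_in_scenery M X \<xi>
    by unfold_locales (rule stationary, rule scenery_indep)
  (* the summand sqrt n makes the gap tend to infinity even if l does not *)
  define g where "g n = l n + nat \<lfloor>sqrt (real n)\<rfloor>" for n
  have l: "\<And>n. 0 < l n" "(\<lambda>n. real (l n)) \<in> o(\<lambda>n. real n)"
    using D by (auto simp: D_cond_with_def)
  have "filterlim (\<lambda>n. nat \<lfloor>sqrt (real n)\<rfloor>) at_top sequentially"
    by real_asymp
  then have g_at_top: "filterlim g at_top sequentially"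
    by (rule filterlim_at_top_mono) (simp add: g_def)
  have "(\<lambda>n. real (nat \<lfloor>sqrt (real n)\<rfloor>)) \<in> o(\<lambda>n. real n)"
    by real_asymp
  from sum_in_smallo(1)[OF l(2) this] have g_small: "(\<lambda>n. real (g n)) \<in> o(\<lambda>n. real n)"
    by (simp add: g_def)
  have l_le: "l n \<le> g n" and g_pos: "0 < g n" for n
    using l(1)[of n] by (auto simp: g_def)
  show ?thesis
    by (rule D_cond_of_eventually_small[OF prob g_pos g_small],
        rule discrepancy_eventually_small[OF walk_transient tau_pos tail D D' g_at_top l_le])
qed

end
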